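(* Let $q$ be complex with $0<|q|<1$ and fix a fifth root $q^{1/5}$ of $q$ (so $q^{k/5}:=(q^{1/5})^k$), and set $R(q^n):=(q^{1/5})^nH(q^n)/G(q^n)$ for positive integers $n$. Define \begin{align*} S&:=G^2(q)H(q^2)G(q^3)H^2(q^4)H(q^{12}),\\ T&:=H^2(q)G(q^2)H(q^3)G^2(q^4)G(q^{12}),\\ U&:=G^3(q)H^3(q)H(q^6)-H^3(q^2)G(q^3)H(q^3),\\ V&:=G^3(q)H^3(q)G(q^6)-G^3(q^2)G(q^3)H(q^3),\\ W&:=H^3(q)G(q^6)H(q^6)-G^3(q^2)H^3(q^2)H(q^3),\\ X&:=G^3(q)G(q^6)H(q^6)-G^3(q^2)H^3(q^2)G(q^3),\\ Y&:=G^3(q^2)H(q^3)G(q^{12})-H^3(q)G^3(q^4)G(q^6),\\ Z&:=H^3(q^2)G(q^3)H(q^{12})-G^3(q)H^3(q^4)H(q^6). \end{align*} Then \begin{align*} &\frac{H(q)H^2(q^3)G(q^{12})+q G(q)G^2(q^3)H(q^{12})}{G(q)G(q^3)H(q^6)G(q^{12})+q^2H(q)H(q^3)G(q^6)H(q^{12})}=\frac{\chi(q^5)\chi(-q^{10})}{\chi(-q^{6})\chi(q^{15})},\\ &\frac{UG(q^2)H(q^3)G(q^{12})-q VH(q^2)G(q^3)H(q^{12})}{VH(q^2)H(q^6)G(q^{12})-q^2 UG(q^2)G(q^6)H(q^{12})}=\frac{\chi(q^5)\chi(-q^{10})}{\chi(-q^{6})\chi(q^{15})},\\ &\frac{WG(q)H(q^{12})G(q^{24})-q^2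 X H(q)G(q^{12})H(q^{24})}{q^4WG(q)G(q^6)H(q^{24})-X H(q)H(q^6)G(q^{24})}=q^3\frac{\chi(q^{10})\chi(-q^{12})\chi(-q^{20})\chi(-q^{30})}{\chi^3(-q^{60})},\\ &\frac{SYH(q^{12})G(q^{24})-q^2TZG(q^{12})H(q^{24})}{TZH(q^6)G(q^{24})-q^4SYG(q^6)H(q^{24})}=q^3\frac{\chi(q^{10})\chi(-q^{12})\chi(-q^{20})\chi(-q^{30})}{\chi^3(-q^{60})},\\ &\frac{V}{q^{6/5}U}=\frac{R(q)R(q^3)}{R^2(q^2)R(q^6)},\qquad \frac{q^{3/5}W}{X}=R^2(q)R(q^2)R(q^3)R(q^6),\qquad \frac{Y}{q^3Z}=\frac{R(q)}{R(q^2)R(q^4)}. \end{align*}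
   Context: For complex $a$ and $|q|<1$, $(a;q)_\infty:=\prod_{k=0}^{\infty}(1-aq^k)$, and $\chi(q):=(-q;q^2)_\infty$. The Rogers–Ramanujan functions are $G(q):=\frac{1}{(q;q^5)_\infty(q^4;q^5)_\infty}$ and $H(q):=\frac{1}{(q^2;q^5)_\infty(q^3;q^5)_\infty}$. The Rogers–Ramanujan continued fraction is $R(q)=q^{1/5}H(q)/G(q)$. Powers such as $G^3(x)$ mean $(G(x))^3$. *)

theory Defs
  imports "HOL-Analysis.Analysis"
begin

text \<open>The $q$-shifted factorial $(a;q)_\infty$; the product converges for $|q| < 1$.\<close>

definition qpoch_inf :: "complex \<Rightarrow> complex \<Rightarrow> complex" where
  "qpoch_inf a q = (\<Prod>k. 1 - a * q ^ k)"

definition chi :: "complex \<Rightarrow> complex" where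
  "chi q = qpoch_inf (- q) (q ^ 2)"

text \<open>The Rogers--Ramanujan functions $G$ and $H$.\<close>

definition rr_G :: "complex \<Rightarrow> complex" where
  "rr_G q = 1 / (qpoch_inf q (q ^ 5) * qpoch_inf (q ^ 4) (q ^ 5))"

definition rr_H :: "complex \<Rightarrow> complex" where
  "rr_H q = 1 / (qpoch_inf (q ^ 2) (q ^ 5) * qpoch_inf (q ^ 3) (q ^ 5))"

text \<open>
  The Rogers--Ramanujan continued fraction $R(x) = x^{1/5} H(x) / G(x)$. It is multivalued in
  $x$, so the fifth root of $x$ is passed as the separate argument \<open>r\<close> (with $r^5 = x$).
\<close>

definition rr_R :: "complex \<Rightarrow> complex \<Rightarrow> complex" where
  "rr_R r x = r * rr_H x / rr_G x"

end

theory Submission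
  imports Defs "HOL-Complex_Analysis.Complex_Analysis"
begin

text \<open>
  Write $\theta(x;p) = (x;p)_\infty (p/x;p)_\infty$, so that $G(q) = 1/\theta(q;q^5)$ and
  $H(q) = 1/\theta(q^2;q^5)$. Everything follows from one three-term theta relation for the pair
  $\psi(z) = \theta(Qz;Q^5)\theta(Q/z;Q^5)$, $\phi(z) = \theta(Q^2z;Q^5)\theta(Q^2/z;Q^5)$, namely
  $\phi(z)\psi(y) - \psi(z)\phi(y) = -(Q/y)\,\theta(yz)\theta(y/z)\theta(Q)\theta(Q^2)$.
  At a torsion point $z$ (a root of unity, a root of unity times $Q^{5/2}$, or $\pm Q^{5/3}$,
  $\pm Q^{5/6}$) the values $\psi(z)$ and $\phi(z)$ are, up to explicit elementary factors, monomials
  in the $G(q^n)$, $H(q^n)$. Hence each two-term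
  combination occurring in the theorem is a product, which is either evaluated in terms of $\chi$
  or cancels between two instances of the relation.

  Knowing $V/U$, $W/X$, $Y/Z$ turns the second, third and fourth quotients into
  quotients of two-term combinations with the same constant $\theta(Q)\theta(Q^2)$, where
  $Q = q^3$ for the first two identities and $Q = q^6$ for the next two. The denominators $U$, $X$, $Z$ are
  nonzero because $H^3(x)G(x^3) \neq G^3(x)H(x^3)$ at $x = q^2$, $q$, $-q$ respectively.
\<close>

section \<open>Infinite products and theta functions\<close>

text \<open>None of \<open>U\<close>, ..., \<open>Z\<close> is ever evaluated by itself; only the
  three ratios are. Each ratio is rewritten as \<open>V * m = U * m'\<close> with monomials
  \<open>m\<close>, \<open>m'\<close>; expanding and regrouping turns this into an equality of two
  binomials. Each binomial is a monomial multiple of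
  \<open>phi Q z * psi Q y - psi Q z * phi Q y\<close> at its own torsion pair (z, y), the pairs
  being chosen so that the two theta products on the right agree up to an elementary factor and need
  not be computed. With w a primitive cube root of unity, the pairs are (w, -1) and (-w, 1) for V/U,
  and (1, u w q^5) and (w, u q^5) with Q = q^2 for the others: u = 1 gives W/X, u = -1 gives Y/Z.
  For the chi quotients y is q^5 (first and third) or -q^5 (second and fourth), and z is i on one
  side of the fraction bar and i Q^(5/2) on the other. At these two z the pair theta(yz) theta(y/z)
  collapses to a single theta of base Q^10, and for y = q^5 or -q^5 that theta is a quotient of
  values of chi.\<close>

lemma qpoch_inf_convergent:
  fixes a q :: complex
  assumes "norm q < 1"
  shows "convergent_prod (\<lambda>k. 1 - a * q ^ k)"
proof -
  have "summable (\<lambda>k. norm a * norm q ^ k)"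
    using assms by (intro summable_mult summable_geometric) auto
  then have "summable (\<lambda>k. norm ((1 - a * q ^ k) - 1))"
    by (simp add: norm_mult norm_power)
  then show ?thesis
    by (intro abs_convergent_prod_imp_convergent_prod summable_imp_abs_convergent_prod)
qed

lemma qpoch_inf_has_prod:
  "norm q < 1 \<Longrightarrow> (\<lambda>k. 1 - a * q ^ k) has_prod qpoch_inf a q"
  unfolding qpoch_inf_def by (intro convergent_prod_has_prod qpoch_inf_convergent)

lemma qpoch_inf_LIMSEQ:
  assumes "norm q < 1"
  shows "(\<lambda>n. \<Prod>k<n. 1 - a * q ^ k) \<longlonglongrightarrow> qpoch_inf a q"
  using convergent_prod_LIMSEQ[OF qpoch_inf_convergent[OF assms, of a]]
  unfolding qpoch_inf_def by (subst (asm) LIMSEQ_lessThan_iff_atMost [symmetric])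

lemma qpoch_inf_eq_0_iff:
  "norm q < 1 \<Longrightarrow> qpoch_inf a q = 0 \<longleftrightarrow> (\<exists>k. a * q ^ k = 1)"
  using has_prod_eq_0_iff[OF qpoch_inf_has_prod, of q a]
  by (auto simp: image_iff)

lemma qpoch_inf_nonzero:
  assumes "norm q < 1" "norm a \<le> 1" "a \<noteq> 1"
  shows "qpoch_inf a q \<noteq> 0"
proof
  assume "qpoch_inf a q = 0"
  then obtain k where k: "a * q ^ k = 1"
    using qpoch_inf_eq_0_iff assms(1) by blast
  then have "k \<noteq> 0" using assms(3) by (cases k) auto
  then have "norm q ^ k < 1"
    using assms(1) by (simp add: power_less_one_iff)
  moreover have "norm a * norm q ^ k = 1"
    using k by (metis norm_mult norm_one norm_power)
  moreover have "norm a * norm q ^ k \<le> 1 * norm q ^ k"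
    using assms(2) by (intro mult_right_mono) auto
  ultimately show False by linarith
qed

lemma qpoch_inf_rec:
  assumes "norm q < 1"
  shows "qpoch_inf a q = (1 - a) * qpoch_inf (a * q) q"
proof (rule LIMSEQ_unique)
  show "(\<lambda>n. \<Prod>k<Suc n. 1 - a * q ^ k) \<longlonglongrightarrow> qpoch_inf a q"
    using qpoch_inf_LIMSEQ[OF assms] by (rule LIMSEQ_Suc)
  have "(\<lambda>n. (1 - a) * (\<Prod>k<n. 1 - (a * q) * q ^ k)) \<longlonglongrightarrow> (1 - a) * qpoch_inf (a * q) q"
    by (intro tendsto_intros qpoch_inf_LIMSEQ assms)
  then show "(\<lambda>n. \<Prod>k<Suc n. 1 - a * q ^ k) \<longlonglongrightarrow> (1 - a) * qpoch_inf (a * q) q"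
    by (subst prod.lessThan_Suc_shift) (simp add: mult_ac)
qed

lemma qpoch_inf_residues:
  assumes "norm q < 1" "0 < n"
  shows "qpoch_inf a q = (\<Prod>j<n. qpoch_inf (a * q ^ j) (q ^ n))"
proof (rule LIMSEQ_unique)
  have qn: "norm (q ^ n) < 1"
    using assms by (simp add: norm_power power_less_one_iff)
  have "filterlim (\<lambda>N. N * n) sequentially sequentially"
    by (rule filterlim_subseq) (use assms(2) in \<open>auto simp: strict_mono_def\<close>)
  then show "(\<lambda>N. \<Prod>k<N * n. 1 - a * q ^ k) \<longlonglongrightarrow> qpoch_inf a q"
    using filterlim_compose[OF qpoch_inf_LIMSEQ[OF assms(1), of a]] by blast
  have "(\<Prod>k<N * n. 1 - a * q ^ k) = (\<Prod>j<n. \<Prod>i<N. 1 - (a * q ^ j) * (q ^ n) ^ i)" for N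
  proof -
    have "(\<Prod>k<N * n. 1 - a * q ^ k) = (\<Prod>i<N. \<Prod>k=i*n..<i*n+n. 1 - a * q ^ k)"
      by (rule prod.nat_group [symmetric])
    also have "\<dots> = (\<Prod>i<N. \<Prod>j<n. 1 - (a * q ^ j) * (q ^ n) ^ i)"
    proof (rule prod.cong [OF refl])
      fix i
      have "(\<Prod>k=i*n..<i*n+n. 1 - a * q ^ k) = (\<Prod>j=0..<n. 1 - a * q ^ (j + i * n))"
        using prod.shift_bounds_nat_ivl[of "\<lambda>k. 1 - a * q ^ k" 0 "i*n" n] by (simp add: add.commute)
      then show "(\<Prod>k=i*n..<i*n+n. 1 - a * q ^ k) = (\<Prod>j<n. 1 - (a * q ^ j) * (q ^ n) ^ i)"
        by (simp add: power_add power_mult [symmetric] mult_ac atLeast0LessThan)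
    qed
    also have "\<dots> = (\<Prod>j<n. \<Prod>i<N. 1 - (a * q ^ j) * (q ^ n) ^ i)"
      by (rule prod.swap)
    finally show ?thesis .
  qed
  moreover have "(\<lambda>N. \<Prod>j<n. \<Prod>i<N. 1 - (a * q ^ j) * (q ^ n) ^ i)
      \<longlonglongrightarrow> (\<Prod>j<n. qpoch_inf (a * q ^ j) (q ^ n))"
    by (intro tendsto_prod qpoch_inf_LIMSEQ qn)
  ultimately show "(\<lambda>N. \<Prod>k<N * n. 1 - a * q ^ k) \<longlonglongrightarrow> (\<Prod>j<n. qpoch_inf (a * q ^ j) (q ^ n))"
    by simp
qed

lemma qpoch_inf_mult_minus:
  assumes "norm q < 1"
  shows "qpoch_inf a q * qpoch_inf (- a) q = qpoch_inf (a ^ 2) (q ^ 2)"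
proof -
  have "qpoch_inf a q * qpoch_inf (- a) q = (\<Prod>k. (1 - a * q ^ k) * (1 - (- a) * q ^ k))"
    unfolding qpoch_inf_def by (intro prodinf_mult qpoch_inf_convergent assms)
  also have "(\<lambda>k. (1 - a * q ^ k) * (1 - (- a) * q ^ k)) = (\<lambda>k. 1 - a ^ 2 * (q ^ 2) ^ k)"
    by (auto simp: algebra_simps power2_eq_square power_mult_distrib)
  finally show ?thesis unfolding qpoch_inf_def .
qed

lemma cube_root_unity_factor:
  fixes w x :: complex
  assumes "w ^ 2 + w + 1 = 0"
  shows "(1 - x) * (1 - w * x) * (1 - x / w) = 1 - x ^ 3"
proof -
  have w0: "w \<noteq> 0" using assms by auto
  have iw: "1 / w = - 1 - w"
    using assms w0 by (simp add: field_simps power2_eq_square) (metis add.assoc add.commute add_eq_0_iff minus_add_distrib)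
  have "x / w = (- 1 - w) * x" using iw by (metis mult.commute times_divide_eq_right mult.right_neutral)
  then show ?thesis using assms by simp algebra
qed

lemma qpoch_inf_mult_cube_roots:
  assumes "norm q < 1" "w ^ 2 + w + 1 = 0"
  shows "qpoch_inf a q * qpoch_inf (w * a) q * qpoch_inf (a / w) q = qpoch_inf (a ^ 3) (q ^ 3)"
proof -
  have "qpoch_inf a q * qpoch_inf (w * a) q = (\<Prod>k. (1 - a * q ^ k) * (1 - w * a * q ^ k))"
    unfolding qpoch_inf_def by (intro prodinf_mult qpoch_inf_convergent assms)
  then have "qpoch_inf a q * qpoch_inf (w * a) q * qpoch_inf (a / w) q
     = (\<Prod>k. (1 - a * q ^ k) * (1 - w * a * q ^ k) * (1 - a / w * q ^ k))"
    unfolding qpoch_inf_def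
    using prodinf_mult[OF convergent_prod_mult[OF qpoch_inf_convergent[OF assms(1), of a]
        qpoch_inf_convergent[OF assms(1), of "w * a"]] qpoch_inf_convergent[OF assms(1), of "a / w"]]
    by simp
  also have "(\<lambda>k. (1 - a * q ^ k) * (1 - w * a * q ^ k) * (1 - a / w * q ^ k))
     = (\<lambda>k. 1 - a ^ 3 * (q ^ 3) ^ k)"
    using cube_root_unity_factor[OF assms(2)]
    by (auto simp: power_mult_distrib power_mult [symmetric] mult.assoc mult.commute [of 3]
        times_divide_eq_left)
  finally show ?thesis unfolding qpoch_inf_def .
qed

definition theta :: "complex \<Rightarrow> complex \<Rightarrow> complex" where
  "theta x p = qpoch_inf x p * qpoch_inf (p / x) p"

lemma theta_reflect: "p \<noteq> 0 \<Longrightarrow> theta (p / x) p = theta x p"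
  by (cases "x = 0") (auto simp: theta_def)

lemma theta_shift:
  assumes "norm p < 1" "p \<noteq> 0" "x \<noteq> 0"
  shows "theta (p * x) p = - theta x p / x"
proof -
  have "x * (1 - 1 / x) = - (1 - x)"
    using assms(3) by (simp add: field_simps)
  then have "x * (qpoch_inf (p * x) p * qpoch_inf (1 / x) p)
      = - ((1 - x) * qpoch_inf (x * p) p * qpoch_inf (1 / x * p) p)"
    using qpoch_inf_rec[OF assms(1), of "1 / x"] by (simp add: mult_ac) algebra
  also have "\<dots> = - (qpoch_inf x p * qpoch_inf (p / x) p)"
    using qpoch_inf_rec[OF assms(1), of x] by simp
  finally show ?thesis
    using assms by (simp add: theta_def field_simps)
qed

lemma theta_inverse:
  assumes "norm p < 1" "p \<noteq> 0" "x \<noteq> 0"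
  shows "theta (1 / x) p = - theta x p / x"
  using theta_shift[OF assms] theta_reflect[OF assms(2), of "1 / x"] by simp

lemma theta_one [simp]:
  assumes "norm p < 1"
  shows "theta 1 p = 0"
  using qpoch_inf_rec[OF assms, of 1] by (simp add: theta_def)

lemma theta_nonzero:
  assumes "norm p < 1" "norm p < norm x" "norm x \<le> 1" "x \<noteq> 1"
  shows "theta x p \<noteq> 0"
proof -
  have "norm (p / x) < 1"
    using assms by (auto simp: norm_divide divide_less_eq_1)
  then have "p / x \<noteq> 1" by auto
  then show ?thesis
    using assms \<open>norm (p / x) < 1\<close> by (simp add: theta_def qpoch_inf_nonzero)
qed

lemma theta_mult_minus:
  "norm p < 1 \<Longrightarrow> theta x p * theta (- x) p = theta (x ^ 2) (p ^ 2)"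
  using qpoch_inf_mult_minus[of p x] qpoch_inf_mult_minus[of p "p / x"]
  by (simp add: theta_def power_divide mult_ac)

lemma theta_mult_cube_roots:
  assumes "norm p < 1" "w ^ 2 + w + 1 = 0"
  shows "theta x p * theta (w * x) p * theta (x / w) p = theta (x ^ 3) (p ^ 3)"
  using qpoch_inf_mult_cube_roots[OF assms, of x] qpoch_inf_mult_cube_roots[OF assms, of "p / x"]
  by (simp add: theta_def power_divide mult_ac)

lemma theta_split2:
  assumes "norm p < 1" "p \<noteq> 0" "x \<noteq> 0"
  shows "theta x p = theta x (p ^ 2) * theta (x * p) (p ^ 2)"
  using qpoch_inf_residues[OF assms(1), of 2 x] qpoch_inf_residues[OF assms(1), of 2 "p / x"] assms
  by (simp add: theta_def numeral_2_eq_2 power2_eq_square field_simps)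

lemma theta_split3:
  assumes "norm p < 1" "p \<noteq> 0" "x \<noteq> 0"
  shows "theta x p = theta x (p ^ 3) * theta (x * p) (p ^ 3) * theta (x * p ^ 2) (p ^ 3)"
  using qpoch_inf_residues[OF assms(1), of 3 x] qpoch_inf_residues[OF assms(1), of 3 "p / x"] assms
  by (simp add: theta_def eval_nat_numeral field_simps)

lemma rr_G_eq_theta: "q \<noteq> 0 \<Longrightarrow> rr_G q = 1 / theta q (q ^ 5)"
  by (simp add: rr_G_def theta_def eval_nat_numeral)

lemma rr_H_eq_theta: "q \<noteq> 0 \<Longrightarrow> rr_H q = 1 / theta (q ^ 2) (q ^ 5)"
  by (simp add: rr_H_def theta_def eval_nat_numeral)

section \<open>The three-term relation\<close>

lemma qpoch_inf_holomorphic: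
  assumes q: "norm q < 1"
  shows "(\<lambda>a. qpoch_inf a q) holomorphic_on A"
proof (rule holomorphic_on_subset)
  show "(\<lambda>a. qpoch_inf a q) holomorphic_on UNIV"
  proof (rule holomorphic_uniform_sequence)
    fix z :: complex
    let ?P = "\<lambda>n a. \<Prod>k<n. 1 - a * q ^ k"
    have "uniformly_convergent_on (cball z 1) (\<lambda>N x. \<Sum>n<N. norm ((1 - x * q ^ n) - 1))"
    proof (rule Weierstrass_m_test')
      show "summable (\<lambda>n. (norm z + 1) * norm q ^ n)"
        using q by (intro summable_mult summable_geometric) auto
      fix n x
      assume "x \<in> cball z 1"
      then have "norm x \<le> norm z + 1"
        using norm_triangle_ineq2 [of x z] by (auto simp: dist_norm norm_minus_commute)
      then show "norm (norm ((1 - x * q ^ n) - 1)) \<le> (norm z + 1) * norm q ^ n"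
        by (simp add: norm_mult norm_power mult_right_mono)
    qed
    then have "uniformly_convergent_on (cball z 1) ?P"
      by (intro uniformly_convergent_on_prod') (auto intro!: continuous_intros)
    then obtain l where l: "uniform_limit (cball z 1) ?P l sequentially"
      by (auto simp: uniformly_convergent_on_def)
    have "l x = qpoch_inf x q" if "x \<in> cball z 1" for x
      using tendsto_uniform_limitI [OF l that] qpoch_inf_LIMSEQ [OF q, of x] by (rule LIMSEQ_unique)
    then have "uniform_limit (cball z 1) ?P (\<lambda>a. qpoch_inf a q) sequentially"
      using l by (metis (mono_tags, lifting) uniform_limit_cong')
    then show "\<exists>d>0. cball z d \<subseteq> UNIV \<and> uniform_limit (cball z d) ?P (\<lambda>a. qpoch_inf a q) sequentially"
      by (intro exI [of _ 1]) auto
  qed (auto intro!: holomorphic_intros)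
qed auto

lemma qpoch_inf_holomorphic_compose [holomorphic_intros]:
  assumes "norm q < 1" "f holomorphic_on A"
  shows "(\<lambda>x. qpoch_inf (f x) q) holomorphic_on A"
  using holomorphic_on_compose [OF assms(2) qpoch_inf_holomorphic [OF assms(1)]]
  by (simp add: o_def)

lemma theta_holomorphic [holomorphic_intros]:
  assumes "norm p < 1" "f holomorphic_on A" "\<And>x. x \<in> A \<Longrightarrow> f x \<noteq> 0"
  shows "(\<lambda>x. theta (f x) p) holomorphic_on A"
  unfolding theta_def by (intro holomorphic_intros assms) (use assms in auto)

definition psi :: "complex \<Rightarrow> complex \<Rightarrow> complex" where
  "psi Q z = theta (Q * z) (Q ^ 5) * theta (Q / z) (Q ^ 5)"

definition phi :: "complex \<Rightarrow> complex \<Rightarrow> complex" where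
  "phi Q z = theta (Q ^ 2 * z) (Q ^ 5) * theta (Q ^ 2 / z) (Q ^ 5)"

text \<open>The multiplier 1 / (p y^2) does not depend on \<open>c\<close>. Hence
  \<open>psi Q\<close> and \<open>phi Q\<close>, with c = Q and c = Q^2, transform alike and can be
  compared on one period annulus.\<close>

lemma theta_pair_shift:
  assumes p: "norm p < 1" "p \<noteq> 0" and "c \<noteq> 0" "y \<noteq> 0"
  shows "theta (c * (p * y)) p * theta (c / (p * y)) p = theta (c * y) p * theta (c / y) p / (p * y ^ 2)"
proof -
  have e1: "theta (c * (p * y)) p = - theta (c * y) p / (c * y)"
    using theta_shift [OF p, of "c * y"] assms by (simp add: mult_ac)
  have e2: "theta (c / (p * y)) p = - (c / (p * y)) * theta (c / y) p"
    using theta_shift [OF p, of "c / (p * y)"] assms by (simp add: field_simps)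
  show ?thesis
    unfolding e1 e2 using assms by (simp add: field_simps power2_eq_square)
qed

text \<open>As functions of \<open>y\<close>, both sides are holomorphic away from 0 and are
  multiplied by 1 / (p y^2) under y -> p y, where p = Q^5. A nonzero function of this kind has
  exactly two zeros modulo multiplication by p, whereas the difference \<open>D\<close> of the two
  sides has three: Q, 1/Q and Q^2.\<close>

lemma theta_three_term:
  fixes Q y z :: complex
  assumes Q: "0 < norm Q" "norm Q < 1" and z: "z \<noteq> 0" and y: "y \<noteq> 0"
  shows "phi Q z * psi Q y - psi Q z * phi Q y
    = - (Q / y) * (theta (y * z) (Q ^ 5) * theta (y / z) (Q ^ 5)) * (theta Q (Q ^ 5) * theta (Q ^ 2) (Q ^ 5))"
proof -
  define p where "p = Q ^ 5"
  define r where "r = norm Q"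
  have r: "0 < r" "r < 1" using Q by (auto simp: r_def)
  have Q0: "Q \<noteq> 0" using Q by auto
  have p0: "p \<noteq> 0" using Q0 by (simp add: p_def)
  have np: "norm p = r ^ 5" by (simp add: p_def r_def norm_power)
  have p1: "norm p < 1" using r by (simp add: np power_less_one_iff)
  define C where "C = theta Q p * theta (Q ^ 2) p"
  define D where "D = (\<lambda>y. phi Q z * psi Q y - psi Q z * phi Q y
    + (Q / y) * (theta (y * z) p * theta (y / z) p) * C)"
  have th3: "theta (Q ^ 3) p = theta (Q ^ 2) p"
    using theta_reflect [OF p0, of "Q ^ 2"] Q0 by (simp add: p_def eval_nat_numeral)
  have D_hol: "D holomorphic_on S" if "0 \<notin> S" for S
    unfolding D_def psi_def phi_def p_def [symmetric] C_def
    by (intro holomorphic_intros p1) (use that Q0 z in auto)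
  have psi_shift: "psi Q (p * y) = psi Q y / (p * y ^ 2)" if "y \<noteq> 0" for y
    using theta_pair_shift [OF p1 p0 Q0 that] by (simp add: psi_def p_def)
  have phi_shift: "phi Q (p * y) = phi Q y / (p * y ^ 2)" if "y \<noteq> 0" for y
    using theta_pair_shift [OF p1 p0 _ that, of "Q ^ 2"] Q0 by (simp add: phi_def p_def)
  have D_shift: "D (p * y) = D y / (p * y ^ 2)" if y: "y \<noteq> 0" for y
  proof -
    have e: "theta (p * y * z) p = - theta (y * z) p / (y * z)" "theta (p * y / z) p = - theta (y / z) p / (y / z)"
      using theta_shift [OF p1 p0, of "y * z"] theta_shift [OF p1 p0, of "y / z"] y z by (simp_all add: mult_ac)
    show ?thesis
      unfolding D_def psi_shift [OF y] phi_shift [OF y] e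
      using p0 y z by (simp add: field_simps power2_eq_square)
  qed
  \<comment> \<open>At Q and 1/Q, \<open>psi Q\<close> vanishes and \<open>phi Q\<close> equals
    \<open>C\<close>; at Q^2, \<open>phi Q\<close> vanishes and \<open>psi Q\<close> equals -C/Q. In
    each case the surviving term cancels against the theta product.\<close>
  have D1: "D Q = 0"
    using p1 Q0 th3 by (simp add: D_def psi_def phi_def p_def [symmetric] C_def
        power2_eq_square power3_eq_cube mult_ac)
  have D2: "D (1 / Q) = 0"
  proof -
    have e1: "theta (1 / Q * z) p = - theta (Q / z) p / (Q / z)"
      using theta_inverse [OF p1 p0, of "Q / z"] Q0 z by simp
    have e2: "theta (1 / Q / z) p = - theta (Q * z) p / (Q * z)"
      using theta_inverse [OF p1 p0, of "Q * z"] Q0 z by simp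
    have e3: "psi Q (1 / Q) = 0"
      using p1 Q0 by (simp add: psi_def p_def [symmetric])
    have e4: "phi Q (1 / Q) = C"
      using Q0 th3 by (simp add: phi_def C_def p_def [symmetric] power2_eq_square power3_eq_cube mult_ac)
    show ?thesis
      unfolding D_def e1 e2 e3 e4 using Q0 z by (simp add: psi_def p_def [symmetric] field_simps)
  qed
  have D3: "D (Q ^ 2) = 0"
  proof -
    have e: "theta (Q / Q ^ 2) p = - theta Q p / Q"
      using theta_inverse [OF p1 p0 Q0] Q0 by (simp add: power2_eq_square field_simps)
    have "Q * Q ^ 2 = Q ^ 3" by (simp add: eval_nat_numeral)
    then have e1: "psi Q (Q ^ 2) = - C / Q"
      by (simp add: psi_def p_def [symmetric] e th3 C_def)
    have e2: "phi Q (Q ^ 2) = 0"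
      using p1 Q0 by (simp add: phi_def p_def [symmetric])
    show ?thesis
      unfolding D_def e1 e2 using Q0 by (simp add: phi_def p_def [symmetric] power2_eq_square field_simps)
  qed
  \<comment> \<open>\<open>D\<close> and \<open>psi Q\<close> have the same quasi-periodicity, and on the annulus \<open>A\<close> the only zeros of
    \<open>psi Q\<close> are the simple ones at \<open>Q\<close> and \<open>1 / Q\<close>, where \<open>D\<close> vanishes too. So their quotient is
    holomorphic on \<open>A\<close>, and it attains its maximum because \<open>A\<close> contains a closed fundamental annulus
    for multiplication by \<open>p\<close>.\<close>
  define A where "A = {y::complex. r ^ 3 < norm (y - 0) \<and> norm (y - 0) < 1 / r ^ 3}"
  have A: "open A" "connected A"
    unfolding A_def
    by (intro open_Collect_conj open_Collect_less continuous_intros) (intro connected_annulus, simp)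
  have A0: "0 \<notin> A" using r by (auto simp: A_def)
  have A': "y \<in> A \<longleftrightarrow> r ^ 3 < norm y \<and> norm y * r ^ 3 < 1" for y
    using r by (simp add: A_def field_simps)
  \<comment> \<open>Two successive divided differences: \<open>E\<close> is D / ((y - Q) (y - 1/Q)),
    with the removable singularities filled by derivatives.\<close>
  define F where "F = (\<lambda>y. if y = Q then deriv D Q else (D y - D Q) / (y - Q))"
  define E where "E = (\<lambda>y. if y = 1 / Q then deriv F (1 / Q) else (F y - F (1 / Q)) / (y - 1 / Q))"
  have E_hol: "E holomorphic_on A"
    unfolding E_def F_def by (intro pole_lemma_open D_hol A A0)
  have QQ: "1 / Q \<noteq> Q"
  proof
    assume "1 / Q = Q"
    then have "Q * Q = 1" using Q0 by (simp add: field_simps)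
    then have "r * r = 1" unfolding r_def by (metis norm_mult norm_one)
    with r show False by (metis less_1_mult mult_strict_mono' not_less_iff_gr_or_eq mult.right_neutral less_eq_real_def)
  qed
  have F2: "F (1 / Q) = 0" using QQ by (simp add: F_def D1 D2)
  have E: "D y = (y - Q) * (y - 1 / Q) * E y" for y
    using D1 D2 F2 by (cases "y = Q"; cases "y = 1 / Q") (auto simp: E_def F_def)
  \<comment> \<open>What remains of \<open>psi Q y\<close> after splitting off the leading factors 1
    - Qy and 1 - Q/y. Its own zeros have modulus at most r^4 or at least r^(-4), hence lie outside
    \<open>A\<close>.\<close>
  define R where "R = (\<lambda>y. qpoch_inf (Q ^ 6 * y) p * qpoch_inf (Q ^ 4 / y) p
      * (qpoch_inf (Q ^ 6 / y) p * qpoch_inf (Q ^ 4 * y) p))"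
  have psi_R: "psi Q y = (1 - Q * y) * (1 - Q / y) * R y" if "y \<noteq> 0" for y
  proof -
    have e: "p / (Q * y) = Q ^ 4 / y" "p / (Q / y) = Q ^ 4 * y" "Q * y * p = Q ^ 6 * y" "Q / y * p = Q ^ 6 / y"
      using Q0 by (simp_all add: p_def eval_nat_numeral)
    show ?thesis
      unfolding psi_def theta_def p_def [symmetric] e R_def
        qpoch_inf_rec [OF p1, of "Q * y"] qpoch_inf_rec [OF p1, of "Q / y"]
      by simp
  qed
  have R0: "R y \<noteq> 0" if "y \<in> A" for y
  proof -
    have y: "r ^ 3 < norm y" "norm y * r ^ 3 < 1" "0 < norm y" using that A' r A0 by auto
    have yr: "norm y * r ^ n < 1" "r ^ n / norm y < 1" if "3 \<le> n" for n
    proof -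
      have "r ^ n \<le> r ^ 3" using r that by (intro power_decreasing) auto
      moreover from this have "norm y * r ^ n \<le> norm y * r ^ 3" by (intro mult_left_mono) auto
      ultimately show "norm y * r ^ n < 1" "r ^ n / norm y < 1"
        using y by (linarith, simp add: divide_less_eq)
    qed
    have *: "qpoch_inf a p \<noteq> 0" if "norm a < 1" for a
      using that by (intro qpoch_inf_nonzero p1) auto
    show ?thesis
      unfolding R_def
      using yr [of 4] yr [of 6]
      by (auto intro!: * simp: norm_mult norm_divide norm_power r_def [symmetric] mult.commute)
  qed
  have R_hol: "R holomorphic_on A"
    unfolding R_def by (intro holomorphic_intros p1) (use A0 in auto)
  \<comment> \<open>Since (1 - Qy)(1 - Q/y) = -Q (y - Q)(y - 1/Q) / y, this is -Q D / psi continued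
    across Q and 1/Q.\<close>
  define g where "g = (\<lambda>y. y * E y / R y)"
  have g_hol: "g holomorphic_on A"
    unfolding g_def by (intro holomorphic_intros E_hol R_hol) (use R0 in auto)
  have g_eq: "g y = - Q * D y / psi Q y" if "y \<in> A" "y \<noteq> Q" "y \<noteq> 1 / Q" for y
  proof -
    have "y \<noteq> 0" using that A0 by auto
    moreover have "1 - Q * y \<noteq> 0" using that(3) Q0 by (auto simp: field_simps)
    moreover have "y - Q \<noteq> 0" using that(2) by auto
    ultimately show ?thesis
      using R0 [OF that(1)] Q0 unfolding g_def E psi_R [OF \<open>y \<noteq> 0\<close>]
      by (simp add: divide_simps) (simp add: algebra_simps)
  qed
  have g_shift: "g (p * y) = g y" if "y \<in> A" "p * y \<in> A" for y
  proof -
    \<comment> \<open>If y and p y both lie in \<open>A\<close>, then |y| exceeds r^(-2) and |p y|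
      is below r^2. So neither is Q or 1/Q, and the quotient formula \<open>g_eq\<close> applies at
      both points.\<close>
    have y0: "y \<noteq> 0" using that A0 by auto
    have n: "r ^ 5 * norm y > r ^ 3" "norm y * r ^ 3 < 1"
      using that np unfolding A' by (auto simp: norm_mult)
    have r1: "r ^ 3 > r ^ 4" "r ^ 3 > r ^ 6" using r by (auto intro!: power_strict_decreasing)
    have "y \<noteq> Q" using n r1 by (auto simp: r_def eval_nat_numeral mult_ac)
    moreover have "y \<noteq> 1 / Q" using n r1 r by (auto simp: r_def norm_divide eval_nat_numeral mult_ac)
    moreover have "p * y \<noteq> Q"
    proof
      assume "p * y = Q"
      then have "r ^ 5 * norm y = r" by (metis np norm_mult r_def)
      then have "norm y * r ^ 3 = 1 / r" using r by (simp add: field_simps eval_nat_numeral)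
      with n r show False by (simp add: field_simps)
    qed
    moreover have "p * y \<noteq> 1 / Q"
    proof
      assume "p * y = 1 / Q"
      then have "r ^ 5 * norm y = 1 / r" by (metis np norm_mult r_def norm_divide norm_one)
      then have "norm y * r ^ 3 = 1 / r ^ 3" using r by (simp add: field_simps eval_nat_numeral)
      moreover have "1 / r ^ 3 > 1" using r by (simp add: power_less_one_iff)
      ultimately show False using n by simp
    qed
    ultimately show ?thesis
      using that p0 y0 by (simp add: g_eq psi_shift D_shift)
  qed
  \<comment> \<open>s = r^(5/2), so s^2 = |p| and multiplication by p carries the circle |y| = 1/s
    onto |y| = s: \<open>K\<close> is a closed fundamental annulus.\<close>
  define s where "s = r ^ 2 * sqrt r"
  have ss: "s * s = r ^ 5" using r by (simp add: s_def eval_nat_numeral)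
  have s: "0 < s" "r ^ 3 < s" "s < r ^ 2"
  proof -
    have "r < sqrt r" using r by (metis real_sqrt_less_iff real_sqrt_abs real_less_rsqrt power2_eq_square mult_less_cancel_left_pos mult.right_neutral)
    moreover have "sqrt r < 1" using r by simp
    ultimately show "0 < s" "r ^ 3 < s" "s < r ^ 2" using r by (auto simp: s_def eval_nat_numeral)
  qed
  define K where "K = cball (0::complex) (1 / s) - ball 0 s"
  have K: "y \<in> K \<longleftrightarrow> s \<le> norm y \<and> norm y * s \<le> 1" for y
    using s by (auto simp: K_def field_simps)
  have KA: "K \<subseteq> A"
  proof
    fix y assume "y \<in> K"
    then have y: "s \<le> norm y" "norm y * s \<le> 1" using K by auto
    have "norm y * r ^ 3 < norm y * s" using y s by (intro mult_strict_left_mono) auto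
    then show "y \<in> A" using y s A' by auto
  qed
  have "compact K" unfolding K_def by (intro compact_diff) auto
  moreover have "s * s \<le> 1" using ss r by (simp add: power_le_one)
  then have "complex_of_real s \<in> K" using s K by auto
  moreover have "continuous_on K (\<lambda>y. norm (g y))"
    by (intro continuous_intros holomorphic_on_imp_continuous_on holomorphic_on_subset [OF g_hol KA])
  ultimately obtain \<xi> where xi: "\<xi> \<in> K" "\<And>y. y \<in> K \<Longrightarrow> norm (g y) \<le> norm (g \<xi>)"
    using continuous_attains_sup [of K "\<lambda>y. norm (g y)"] by blast
  \<comment> \<open>One division or multiplication by p brings any point of \<open>A\<close> into
    \<open>K\<close>, so the maximum over the compact set \<open>K\<close> is a maximum over the
    open set \<open>A\<close>.\<close>
  have sup: "norm (g y) \<le> norm (g \<xi>)" if y: "y \<in> A" for y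
  proof -
    have ny: "norm y > 0" using y A0 by auto
    have yA: "r ^ 3 < norm y" "norm y * r ^ 3 < 1" using y A' by auto
    consider "y \<in> K" | "norm y < s" | "norm y * s > 1" using K by force
    then show ?thesis
    proof cases
      case 1 then show ?thesis using xi by blast
    next
      case 2
      have *: "norm (y / p) = norm y / (s * s)" by (simp add: norm_divide np ss)
      have "y / p \<in> K"
        unfolding K *
      proof
        have "s * s * s \<le> r ^ 5 * r ^ 2"
          unfolding ss using s r by (intro mult_left_mono) auto
        also have "\<dots> \<le> r ^ 3" using r by (simp flip: power_add add: power_decreasing)
        finally have "s * (s * s) \<le> norm y" using yA by (simp add: mult_ac)
        then show "s \<le> norm y / (s * s)" using s by (simp add: field_simps)
        show "norm y / (s * s) * s \<le> 1" using s 2 by simp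
      qed
      then have "norm (g (y / p)) \<le> norm (g \<xi>)" "y / p \<in> A" using xi KA by auto
      then show ?thesis using g_shift [of "y / p"] p0 y by simp
    next
      case 3
      have *: "norm (p * y) = s * s * norm y" by (simp add: norm_mult np ss)
      have "p * y \<in> K"
        unfolding K *
      proof
        show "s \<le> s * s * norm y" using s 3 by (simp add: mult_ac)
        have "s * s * s \<le> r ^ 5 * r ^ 2"
          unfolding ss using s r by (intro mult_left_mono) auto
        also have "\<dots> \<le> r ^ 3" using r by (simp flip: power_add add: power_decreasing)
        finally have "norm y * (s * s * s) \<le> norm y * r ^ 3" by (intro mult_left_mono) auto
        then show "s * s * norm y * s \<le> 1" using yA by (simp add: mult_ac)
      qed
      then have "norm (g (p * y)) \<le> norm (g \<xi>)" "p * y \<in> A" using xi KA by auto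
      then show ?thesis using g_shift [of y] y by simp
    qed
  qed
  have "g constant_on A"
    using maximum_modulus_principle [OF g_hol A A(1) order_refl subsetD [OF KA xi(1)] sup] .
  then obtain c where c: "\<And>y. y \<in> A \<Longrightarrow> g y = c" by (auto simp: constant_on_def)
  have Q2A: "Q ^ 2 \<in> A"
  proof -
    have "r ^ 3 < r ^ 2" using r by (intro power_strict_decreasing) auto
    moreover have "r ^ 2 * r ^ 3 < 1" using r by (simp flip: power_add add: power_less_one_iff)
    ultimately show ?thesis by (simp add: A' norm_power r_def)
  qed
  have "Q ^ 2 \<noteq> Q" "Q ^ 2 \<noteq> 1 / Q"
  proof -
    have "r ^ 2 < r" using r by (simp add: power2_eq_square)
    then show "Q ^ 2 \<noteq> Q" unfolding r_def by (metis norm_power order_less_irrefl)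
    have "r ^ 3 < 1" using r by (simp add: power_less_one_iff)
    then show "Q ^ 2 \<noteq> 1 / Q" unfolding r_def using Q0
      by (metis norm_one norm_power order_less_irrefl power2_eq_square power3_eq_cube nonzero_eq_divide_eq)
  qed
  \<comment> \<open>The third zero, at Q^2, determines the constant.\<close>
  then have "c = 0" using c [OF Q2A] g_eq [OF Q2A] D3 by simp
  then have "E y = 0" if "y \<in> A" for y
    using c [OF that] R0 [OF that] A0 that by (auto simp: g_def)
  then have DA: "D y = 0" if "y \<in> A" for y using E that by simp
  have "D y = 0"
  proof (rule analytic_continuation_open [where f = D and g = "\<lambda>_. 0" and s = A and s' = "- {0}"])
    show "connected (- {0::complex})" by (rule connected_punctured_universe) simp
    show "A \<noteq> {}" using Q2A by auto
  qed (use A A0 D_hol DA y in auto)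
  then show ?thesis
    by (simp add: D_def C_def p_def algebra_simps add_eq_0_iff)
qed

section \<open>Theta values as monomials in $G$ and $H$\<close>

text \<open>Duplication at \<open>x\<close> and at \<open>y\<close>, multiplied together. It serves
  where only the product of two theta values is a known monomial and the single factors are
  not.\<close>

lemma theta_minus_pair:
  assumes "norm p < 1" "theta x p * theta y p = u" "u \<noteq> 0"
    "theta (x ^ 2) (p ^ 2) * theta (y ^ 2) (p ^ 2) = v"
  shows "theta (- x) p * theta (- y) p = v / u"
proof -
  have "u * (theta (- x) p * theta (- y) p) = v"
    unfolding assms(2,4) [symmetric] theta_mult_minus [OF assms(1), symmetric] by (simp only: mult_ac)
  then show ?thesis using assms(3) by (simp add: field_simps)
qed

lemma norm_power_less_one: "norm (q :: complex) < 1 \<Longrightarrow> 0 < n \<Longrightarrow> norm (q ^ n) < 1"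
  by (simp add: norm_power power_less_one_iff)

lemma theta_rr_G: "q \<noteq> 0 \<Longrightarrow> theta q (q ^ 5) = 1 / rr_G q"
  by (simp add: rr_G_eq_theta)

lemma theta_rr_H: "q \<noteq> 0 \<Longrightarrow> theta (q ^ 2) (q ^ 5) = 1 / rr_H q"
  by (simp add: rr_H_eq_theta)

lemma theta_power_nonzero:
  assumes "q \<noteq> 0" "norm q < 1" "0 < m" "m < n"
  shows "theta (q ^ m) (q ^ n) \<noteq> 0" "theta (- (q ^ m)) (q ^ n) \<noteq> 0"
proof -
  have "norm (q ^ m) < 1" "norm (q ^ n) < 1"
    using assms by (auto intro: norm_power_less_one)
  moreover have "norm (q ^ n) < norm (q ^ m)"
    using assms by (simp add: norm_power power_strict_decreasing)
  moreover have "x \<noteq> 1" if "norm x < 1" for x :: complex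
    using that by auto
  ultimately show "theta (q ^ m) (q ^ n) \<noteq> 0" "theta (- (q ^ m)) (q ^ n) \<noteq> 0"
    by (simp_all add: theta_nonzero)
qed

lemma rr_nonzero:
  assumes "q \<noteq> 0" "norm q < 1"
  shows "rr_G q \<noteq> 0" "rr_H q \<noteq> 0"
  using theta_power_nonzero(1) [OF assms, of 1 5] theta_power_nonzero(1) [OF assms, of 2 5] assms
  by (auto simp: rr_G_eq_theta rr_H_eq_theta)

lemma rr_power_nonzero:
  assumes "q \<noteq> 0" "norm q < 1" "0 < n"
  shows "rr_G (q ^ n) \<noteq> 0" "rr_H (q ^ n) \<noteq> 0"
  using rr_nonzero [of "q ^ n"] norm_power_less_one assms by auto

context
  fixes q :: complex
  assumes q0: "q \<noteq> 0" and q1: "norm q < 1"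
begin

lemma theta_reflect_power:
  assumes "m + k = n"
  shows "theta (q ^ m) (q ^ n) = theta (q ^ k) (q ^ n)"
    "theta (- (q ^ m)) (q ^ n) = theta (- (q ^ k)) (q ^ n)"
proof -
  have "q ^ n / q ^ m = q ^ k" "q ^ n / - (q ^ m) = - (q ^ k)"
    using q0 assms by (auto simp: power_add field_simps)
  then show "theta (q ^ m) (q ^ n) = theta (q ^ k) (q ^ n)"
    "theta (- (q ^ m)) (q ^ n) = theta (- (q ^ k)) (q ^ n)"
    using theta_reflect [of "q ^ n"] q0 by (metis power_not_zero)+
qed

lemma theta_minus_rr:
  "theta (- q) (q ^ 5) = rr_G q / rr_G (q ^ 2)"
  "theta (- (q ^ 2)) (q ^ 5) = rr_H q / rr_H (q ^ 2)"
proof -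
  have "norm (q ^ 5) < 1" using q1 by (rule norm_power_less_one) simp
  from theta_mult_minus [OF this, of q] theta_mult_minus [OF this, of "q ^ 2"]
  show "theta (- q) (q ^ 5) = rr_G q / rr_G (q ^ 2)"
    "theta (- (q ^ 2)) (q ^ 5) = rr_H q / rr_H (q ^ 2)"
    using theta_rr_G [of q] theta_rr_G [of "q ^ 2"] theta_rr_H [of q] theta_rr_H [of "q ^ 2"]
      rr_nonzero [OF q0 q1] q0
    by (simp_all add: field_simps flip: power_mult)
qed

lemma theta_cube_roots_rr:
  assumes "w ^ 2 + w + 1 = 0"
  shows "theta (w * q) (q ^ 5) * theta (q / w) (q ^ 5) = rr_G q / rr_G (q ^ 3)"
    "theta (w * q ^ 2) (q ^ 5) * theta (q ^ 2 / w) (q ^ 5) = rr_H q / rr_H (q ^ 3)"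
proof -
  have "norm (q ^ 5) < 1" using q1 by (rule norm_power_less_one) simp
  from theta_mult_cube_roots [OF this assms, of q] theta_mult_cube_roots [OF this assms, of "q ^ 2"]
  show "theta (w * q) (q ^ 5) * theta (q / w) (q ^ 5) = rr_G q / rr_G (q ^ 3)"
    "theta (w * q ^ 2) (q ^ 5) * theta (q ^ 2 / w) (q ^ 5) = rr_H q / rr_H (q ^ 3)"
    using theta_rr_G [of q] theta_rr_G [of "q ^ 3"] theta_rr_H [of q] theta_rr_H [of "q ^ 3"]
      rr_nonzero [OF q0 q1] q0
    by (simp_all add: field_simps flip: power_mult)
qed

text \<open>Splitting base q^5 into base q^10 gives one factor with an even exponent, which is a
  reciprocal of G or H at q^2, and one with an odd exponent, for which the equation is
  solved.\<close>

lemma theta_10: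
  "theta q (q ^ 10) = rr_H (q ^ 2) / rr_G q"
  "theta (q ^ 3) (q ^ 10) = rr_G (q ^ 2) / rr_H q"
proof -
  have p: "norm (q ^ 5) < 1" "q ^ 5 \<noteq> 0" using q1 q0 by (auto intro: norm_power_less_one)
  have "theta q (q ^ 5) = theta q (q ^ 10) * theta (q ^ 6) (q ^ 10)"
    using theta_split2 [OF p q0] by (simp flip: power_mult power_Suc)
  also have "theta (q ^ 6) (q ^ 10) = 1 / rr_H (q ^ 2)"
    using theta_reflect_power(1) [of 6 4 10] theta_rr_H [of "q ^ 2"] q0 by (simp flip: power_mult)
  finally show "theta q (q ^ 10) = rr_H (q ^ 2) / rr_G q"
    using theta_rr_G [OF q0] rr_power_nonzero [OF q0 q1] by (simp add: field_simps)
  have "theta (q ^ 2) (q ^ 5) = theta (q ^ 2) (q ^ 10) * theta (q ^ 7) (q ^ 10)"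
    using theta_split2 [OF p, of "q ^ 2"] q0 by (simp flip: power_mult power_add)
  also have "theta (q ^ 7) (q ^ 10) = theta (q ^ 3) (q ^ 10)"
    by (rule theta_reflect_power) simp
  also have "theta (q ^ 2) (q ^ 10) = 1 / rr_G (q ^ 2)"
    using theta_rr_G [of "q ^ 2"] q0 by (simp flip: power_mult)
  finally show "theta (q ^ 3) (q ^ 10) = rr_G (q ^ 2) / rr_H q"
    using theta_rr_H [OF q0] rr_power_nonzero [OF q0 q1] by (simp add: field_simps)
qed

text \<open>Splitting base q^5 into base q^15 gives three factors. The one whose exponent is
  divisible by 3 is a reciprocal of G or H at q^3, so the product of the other two is
  determined.\<close>

lemma theta_15:
  "theta q (q ^ 15) * theta (q ^ 4) (q ^ 15) = rr_H (q ^ 3) / rr_G q"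
  "theta (q ^ 2) (q ^ 15) * theta (q ^ 7) (q ^ 15) = rr_G (q ^ 3) / rr_H q"
proof -
  have p: "norm (q ^ 5) < 1" "q ^ 5 \<noteq> 0" using q1 q0 by (auto intro: norm_power_less_one)
  have "theta q (q ^ 5) = theta q (q ^ 15) * theta (q ^ 6) (q ^ 15) * theta (q ^ 11) (q ^ 15)"
    using theta_split3 [OF p q0] by (simp flip: power_mult power_Suc)
  also have "theta (q ^ 11) (q ^ 15) = theta (q ^ 4) (q ^ 15)"
    by (rule theta_reflect_power) simp
  also have "theta (q ^ 6) (q ^ 15) = 1 / rr_H (q ^ 3)"
    using theta_rr_H [of "q ^ 3"] q0 by (simp flip: power_mult)
  finally show "theta q (q ^ 15) * theta (q ^ 4) (q ^ 15) = rr_H (q ^ 3) / rr_G q"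
    using theta_rr_G [OF q0] rr_power_nonzero [OF q0 q1] by (simp add: field_simps)
  have "theta (q ^ 2) (q ^ 5) = theta (q ^ 2) (q ^ 15) * theta (q ^ 7) (q ^ 15) * theta (q ^ 12) (q ^ 15)"
    using theta_split3 [OF p, of "q ^ 2"] q0 by (simp flip: power_mult power_add)
  also have "theta (q ^ 12) (q ^ 15) = theta (q ^ 3) (q ^ 15)"
    by (rule theta_reflect_power) simp
  also have "theta (q ^ 3) (q ^ 15) = 1 / rr_G (q ^ 3)"
    using theta_rr_G [of "q ^ 3"] q0 by (simp flip: power_mult)
  finally show "theta (q ^ 2) (q ^ 15) * theta (q ^ 7) (q ^ 15) = rr_G (q ^ 3) / rr_H q"
    using theta_rr_H [OF q0] rr_power_nonzero [OF q0 q1] by (simp add: field_simps)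
qed

end

context
  fixes q :: complex
  assumes q0: "q \<noteq> 0" and q1: "norm q < 1"
begin

lemma q2_disc: "q ^ 2 \<noteq> 0" "norm (q ^ 2) < 1"
  using q0 q1 by (auto intro: norm_power_less_one)

lemmas rr_all_nonzero = rr_nonzero [OF q0 q1] rr_power_nonzero [OF q0 q1]

lemma theta_cube_roots_minus_rr:
  assumes "w ^ 2 + w + 1 = 0"
  shows "theta (- (w * q)) (q ^ 5) * theta (- (q / w)) (q ^ 5)
      = rr_G (q ^ 2) * rr_G (q ^ 3) / (rr_G q * rr_G (q ^ 6))"
    "theta (- (w * q ^ 2)) (q ^ 5) * theta (- (q ^ 2 / w)) (q ^ 5)
      = rr_H (q ^ 2) * rr_H (q ^ 3) / (rr_H q * rr_H (q ^ 6))"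
proof -
  have p: "norm (q ^ 5) < 1" using q1 by (rule norm_power_less_one) simp
  \<comment> \<open>Duplication squares the arguments, so the cube root of unity needed at q^2 is
    w^2.\<close>
  have w2: "(w ^ 2) ^ 2 + w ^ 2 + 1 = 0" using assms by algebra
  have "theta (- (w * q)) (q ^ 5) * theta (- (q / w)) (q ^ 5)
      = rr_G (q ^ 2) / rr_G (q ^ 6) / (rr_G q / rr_G (q ^ 3))"
    by (rule theta_minus_pair [OF p theta_cube_roots_rr(1) [OF q0 q1 assms]])
      (use theta_cube_roots_rr(1) [OF q2_disc w2] rr_all_nonzero in
        \<open>simp_all add: power_mult_distrib power_divide flip: power_mult\<close>)
  then show "theta (- (w * q)) (q ^ 5) * theta (- (q / w)) (q ^ 5)
      = rr_G (q ^ 2) * rr_G (q ^ 3) / (rr_G q * rr_G (q ^ 6))"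
    by (simp add: mult_ac)
  have "theta (- (w * q ^ 2)) (q ^ 5) * theta (- (q ^ 2 / w)) (q ^ 5)
      = rr_H (q ^ 2) / rr_H (q ^ 6) / (rr_H q / rr_H (q ^ 3))"
    by (rule theta_minus_pair [OF p theta_cube_roots_rr(2) [OF q0 q1 assms]])
      (use theta_cube_roots_rr(2) [OF q2_disc w2] rr_all_nonzero in
        \<open>simp_all add: power_mult_distrib power_divide flip: power_mult\<close>)
  then show "theta (- (w * q ^ 2)) (q ^ 5) * theta (- (q ^ 2 / w)) (q ^ 5)
      = rr_H (q ^ 2) * rr_H (q ^ 3) / (rr_H q * rr_H (q ^ 6))"
    by (simp add: mult_ac)
qed

lemma theta_i_rr:
  "theta (\<i> * q) (q ^ 5) * theta (q / \<i>) (q ^ 5) = rr_G (q ^ 2) / rr_G (q ^ 4)"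
  "theta (\<i> * q ^ 2) (q ^ 5) * theta (q ^ 2 / \<i>) (q ^ 5) = rr_H (q ^ 2) / rr_H (q ^ 4)"
proof -
  have p: "norm (q ^ 5) < 1" using q1 by (rule norm_power_less_one) simp
  show "theta (\<i> * q) (q ^ 5) * theta (q / \<i>) (q ^ 5) = rr_G (q ^ 2) / rr_G (q ^ 4)"
    using theta_mult_minus [OF p, of "\<i> * q"] theta_minus_rr(1) [OF q2_disc]
    by (simp add: power_mult_distrib flip: power_mult)
  show "theta (\<i> * q ^ 2) (q ^ 5) * theta (q ^ 2 / \<i>) (q ^ 5) = rr_H (q ^ 2) / rr_H (q ^ 4)"
    using theta_mult_minus [OF p, of "\<i> * q ^ 2"] theta_minus_rr(2) [OF q2_disc]
    by (simp add: power_mult_distrib flip: power_mult)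
qed

lemma theta_minus_10:
  "theta (- q) (q ^ 10) = rr_G q * rr_H (q ^ 4) / (rr_G (q ^ 2) * rr_H (q ^ 2))"
  "theta (- (q ^ 3)) (q ^ 10) = rr_H q * rr_G (q ^ 4) / (rr_G (q ^ 2) * rr_H (q ^ 2))"
proof -
  have p: "norm (q ^ 10) < 1" using q1 by (rule norm_power_less_one) simp
  have "rr_H (q ^ 2) / rr_G q * theta (- q) (q ^ 10) = rr_H (q ^ 4) / rr_G (q ^ 2)"
    using theta_mult_minus [OF p, of q] theta_10(1) [OF q2_disc]
    unfolding theta_10 [OF q0 q1] by (simp flip: power_mult)
  then show "theta (- q) (q ^ 10) = rr_G q * rr_H (q ^ 4) / (rr_G (q ^ 2) * rr_H (q ^ 2))"
    using rr_all_nonzero by (simp add: field_simps)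
  have "rr_G (q ^ 2) / rr_H q * theta (- (q ^ 3)) (q ^ 10) = rr_G (q ^ 4) / rr_H (q ^ 2)"
    using theta_mult_minus [OF p, of "q ^ 3"] theta_10(2) [OF q2_disc]
    unfolding theta_10 [OF q0 q1] by (simp flip: power_mult)
  then show "theta (- (q ^ 3)) (q ^ 10) = rr_H q * rr_G (q ^ 4) / (rr_G (q ^ 2) * rr_H (q ^ 2))"
    using rr_all_nonzero by (simp add: field_simps)
qed

lemma theta_minus_15:
  "theta (- q) (q ^ 15) * theta (- (q ^ 4)) (q ^ 15)
    = rr_H (q ^ 6) * rr_G q / (rr_G (q ^ 2) * rr_H (q ^ 3))"
  "theta (- (q ^ 2)) (q ^ 15) * theta (- (q ^ 7)) (q ^ 15)
    = rr_G (q ^ 6) * rr_H q / (rr_H (q ^ 2) * rr_G (q ^ 3))"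
proof -
  have p: "norm (q ^ 15) < 1" using q1 by (rule norm_power_less_one) simp
  have "theta (- q) (q ^ 15) * theta (- (q ^ 4)) (q ^ 15)
      = rr_H (q ^ 6) / rr_G (q ^ 2) / (rr_H (q ^ 3) / rr_G q)"
    by (rule theta_minus_pair [OF p theta_15(1) [OF q0 q1]])
      (use theta_15(1) [OF q2_disc] rr_all_nonzero in \<open>simp_all flip: power_mult\<close>)
  then show "theta (- q) (q ^ 15) * theta (- (q ^ 4)) (q ^ 15)
      = rr_H (q ^ 6) * rr_G q / (rr_G (q ^ 2) * rr_H (q ^ 3))"
    by simp
  have "theta (- (q ^ 2)) (q ^ 15) * theta (- (q ^ 7)) (q ^ 15)
      = rr_G (q ^ 6) / rr_H (q ^ 2) / (rr_G (q ^ 3) / rr_H q)"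
    by (rule theta_minus_pair [OF p theta_15(2) [OF q0 q1]])
      (use theta_15(2) [OF q2_disc] rr_all_nonzero in \<open>simp_all flip: power_mult\<close>)
  then show "theta (- (q ^ 2)) (q ^ 15) * theta (- (q ^ 7)) (q ^ 15)
      = rr_G (q ^ 6) * rr_H q / (rr_H (q ^ 2) * rr_G (q ^ 3))"
    by simp
qed

text \<open>Each product in \<open>theta_15\<close> is split once more, into base q^30. Its two
  even-exponent factors form the other product of \<open>theta_15\<close> taken at q^2, which leaves
  the odd pair.\<close>

lemma theta_30:
  "theta q (q ^ 30) * theta (q ^ 11) (q ^ 30)
    = rr_H (q ^ 2) * rr_H (q ^ 3) / (rr_G q * rr_G (q ^ 6))"
  "theta (q ^ 7) (q ^ 30) * theta (q ^ 13) (q ^ 30)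
    = rr_G (q ^ 2) * rr_G (q ^ 3) / (rr_H q * rr_H (q ^ 6))"
proof -
  have p: "norm (q ^ 15) < 1" "q ^ 15 \<noteq> 0" using q1 q0 by (auto intro: norm_power_less_one)
  note refl = theta_reflect_power(1) [OF q0 q1]
  have split: "theta q (q ^ 15) = theta q (q ^ 30) * theta (q ^ 14) (q ^ 30)"
    "theta (q ^ 4) (q ^ 15) = theta (q ^ 4) (q ^ 30) * theta (q ^ 11) (q ^ 30)"
    "theta (q ^ 2) (q ^ 15) = theta (q ^ 2) (q ^ 30) * theta (q ^ 13) (q ^ 30)"
    "theta (q ^ 7) (q ^ 15) = theta (q ^ 7) (q ^ 30) * theta (q ^ 8) (q ^ 30)"
    using theta_split2 [OF p q0] theta_split2 [OF p, of "q ^ 4"] theta_split2 [OF p, of "q ^ 2"]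
      theta_split2 [OF p, of "q ^ 7"] q0 refl [of 16 14 30] refl [of 19 11 30] refl [of 17 13 30] refl [of 22 8 30]
    by (simp_all flip: power_mult power_add power_Suc)
  have "theta q (q ^ 30) * theta (q ^ 11) (q ^ 30) * (theta (q ^ 4) (q ^ 30) * theta (q ^ 14) (q ^ 30))
      = rr_H (q ^ 3) / rr_G q"
    using theta_15(1) [OF q0 q1] unfolding split by (simp only: mult_ac)
  moreover have "theta (q ^ 4) (q ^ 30) * theta (q ^ 14) (q ^ 30) = rr_G (q ^ 6) / rr_H (q ^ 2)"
    using theta_15(2) [OF q2_disc] by (simp flip: power_mult)
  ultimately have "theta q (q ^ 30) * theta (q ^ 11) (q ^ 30) * (rr_G (q ^ 6) / rr_H (q ^ 2))
      = rr_H (q ^ 3) / rr_G q"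
    by simp
  then show "theta q (q ^ 30) * theta (q ^ 11) (q ^ 30)
    = rr_H (q ^ 2) * rr_H (q ^ 3) / (rr_G q * rr_G (q ^ 6))"
    using rr_all_nonzero by (simp add: field_simps)
  have "theta (q ^ 7) (q ^ 30) * theta (q ^ 13) (q ^ 30) * (theta (q ^ 2) (q ^ 30) * theta (q ^ 8) (q ^ 30))
      = rr_G (q ^ 3) / rr_H q"
    using theta_15(2) [OF q0 q1] unfolding split by (simp only: mult_ac)
  moreover have "theta (q ^ 2) (q ^ 30) * theta (q ^ 8) (q ^ 30) = rr_H (q ^ 6) / rr_G (q ^ 2)"
    using theta_15(1) [OF q2_disc] by (simp flip: power_mult)
  ultimately have "theta (q ^ 7) (q ^ 30) * theta (q ^ 13) (q ^ 30) * (rr_H (q ^ 6) / rr_G (q ^ 2))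
      = rr_G (q ^ 3) / rr_H q"
    by simp
  then show "theta (q ^ 7) (q ^ 30) * theta (q ^ 13) (q ^ 30)
    = rr_G (q ^ 2) * rr_G (q ^ 3) / (rr_H q * rr_H (q ^ 6))"
    using rr_all_nonzero by (simp add: field_simps)
qed

end

lemma theta_minus_30:
  assumes q0: "q \<noteq> 0" and q1: "norm q < 1"
  shows "theta (- q) (q ^ 30) * theta (- (q ^ 11)) (q ^ 30)
      = rr_H (q ^ 4) * rr_H (q ^ 6) * rr_G q * rr_G (q ^ 6)
        / (rr_G (q ^ 2) * rr_G (q ^ 12) * rr_H (q ^ 2) * rr_H (q ^ 3))"
    "theta (- (q ^ 7)) (q ^ 30) * theta (- (q ^ 13)) (q ^ 30)
      = rr_G (q ^ 4) * rr_G (q ^ 6) * rr_H q * rr_H (q ^ 6)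
        / (rr_H (q ^ 2) * rr_H (q ^ 12) * rr_G (q ^ 2) * rr_G (q ^ 3))"
proof -
  have p: "norm (q ^ 30) < 1" using q1 by (rule norm_power_less_one) simp
  note nz = rr_all_nonzero [OF q0 q1]
  have "theta (- q) (q ^ 30) * theta (- (q ^ 11)) (q ^ 30)
      = rr_H (q ^ 4) * rr_H (q ^ 6) / (rr_G (q ^ 2) * rr_G (q ^ 12))
        / (rr_H (q ^ 2) * rr_H (q ^ 3) / (rr_G q * rr_G (q ^ 6)))"
    by (rule theta_minus_pair [OF p theta_30(1) [OF q0 q1]])
      (use theta_30(1) [OF q2_disc [OF q0 q1]] nz in \<open>simp_all flip: power_mult\<close>)
  then show "theta (- q) (q ^ 30) * theta (- (q ^ 11)) (q ^ 30)
      = rr_H (q ^ 4) * rr_H (q ^ 6) * rr_G q * rr_G (q ^ 6)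
        / (rr_G (q ^ 2) * rr_G (q ^ 12) * rr_H (q ^ 2) * rr_H (q ^ 3))"
    by (simp add: mult_ac)
  have "theta (- (q ^ 7)) (q ^ 30) * theta (- (q ^ 13)) (q ^ 30)
      = rr_G (q ^ 4) * rr_G (q ^ 6) / (rr_H (q ^ 2) * rr_H (q ^ 12))
        / (rr_G (q ^ 2) * rr_G (q ^ 3) / (rr_H q * rr_H (q ^ 6)))"
    by (rule theta_minus_pair [OF p theta_30(2) [OF q0 q1]])
      (use theta_30(2) [OF q2_disc [OF q0 q1]] nz in \<open>simp_all flip: power_mult\<close>)
  then show "theta (- (q ^ 7)) (q ^ 30) * theta (- (q ^ 13)) (q ^ 30)
      = rr_G (q ^ 4) * rr_G (q ^ 6) * rr_H q * rr_H (q ^ 6)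
        / (rr_H (q ^ 2) * rr_H (q ^ 12) * rr_G (q ^ 2) * rr_G (q ^ 3))"
    by (simp add: mult_ac)
qed

text \<open>y / i = -(i y), so the pair is a single duplication. This collapses the right-hand side
  of the three-term relation at z = i.\<close>

lemma theta_pair_i:
  "norm p < 1 \<Longrightarrow> theta (y * \<i>) p * theta (y / \<i>) p = theta (- (y ^ 2)) (p ^ 2)"
  using theta_mult_minus [of p "\<i> * y"] by (simp add: power_mult_distrib mult.commute)

text \<open>After inverting the second argument, the four infinite products pair off as (a, -a),
  because s^2 = p gives p / (c i s) = -(i s / c). Each pair then has base p^2. The lemma serves both
  for the values of \<open>psi\<close> and \<open>phi\<close> at i s and for the theta product on
  the right of the relation there.\<close>

lemma theta_pair_quarter:
  assumes "norm p < 1" "s ^ 2 = p" "p \<noteq> 0" "c \<noteq> 0"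
  shows "theta (c * (\<i> * s)) p * theta (c / (\<i> * s)) p = - (c / (\<i> * s)) * theta (- (p * c ^ 2)) (p ^ 2)"
proof -
  have s0: "s \<noteq> 0" using assms by auto
  have e: "p / (c * (\<i> * s)) = - (\<i> * s / c)" "p / (\<i> * s / c) = - (c * (\<i> * s))"
    "(c * (\<i> * s)) ^ 2 = - (p * c ^ 2)" "(\<i> * s / c) ^ 2 = p ^ 2 / - (p * c ^ 2)"
    using s0 assms(4) unfolding assms(2) [symmetric] by (simp_all add: field_simps power2_eq_square)
  have "theta (c * (\<i> * s)) p * theta (\<i> * s / c) p
      = (qpoch_inf (c * (\<i> * s)) p * qpoch_inf (- (c * (\<i> * s))) p)
        * (qpoch_inf (\<i> * s / c) p * qpoch_inf (- (\<i> * s / c)) p)"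
    unfolding theta_def e(1,2) by (simp only: mult_ac)
  also have "\<dots> = theta (- (p * c ^ 2)) (p ^ 2)"
    unfolding qpoch_inf_mult_minus [OF assms(1)] e(3,4) theta_def ..
  finally have "theta (c * (\<i> * s)) p * theta (\<i> * s / c) p = theta (- (p * c ^ 2)) (p ^ 2)" .
  moreover have "theta (c / (\<i> * s)) p = - (c / (\<i> * s)) * theta (\<i> * s / c) p"
    using theta_inverse [OF assms(1,3), of "\<i> * s / c"] s0 assms by simp
  ultimately show ?thesis
    by (simp only: mult_ac)
qed

section \<open>Values of \<open>psi\<close> and \<open>phi\<close> at torsion points\<close>

context
  fixes q :: complex
  assumes q0: "q \<noteq> 0" and q1: "norm q < 1"
begin

lemma psi_phi_1:
  "psi q 1 = 1 / rr_G q ^ 2" "phi q 1 = 1 / rr_H q ^ 2"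
  using theta_rr_G [OF q0] theta_rr_H [OF q0]
  by (simp_all add: psi_def phi_def power2_eq_square)

lemma psi_phi_minus_1:
  "psi q (- 1) = (rr_G q / rr_G (q ^ 2)) ^ 2" "phi q (- 1) = (rr_H q / rr_H (q ^ 2)) ^ 2"
  using theta_minus_rr [OF q0 q1] by (simp_all add: psi_def phi_def power2_eq_square)

lemma psi_phi_cube_root:
  assumes "w ^ 2 + w + 1 = 0"
  shows "psi q w = rr_G q / rr_G (q ^ 3)" "phi q w = rr_H q / rr_H (q ^ 3)"
  using theta_cube_roots_rr [OF q0 q1 assms] by (simp_all add: psi_def phi_def mult.commute)

lemma psi_phi_minus_cube_root:
  assumes "w ^ 2 + w + 1 = 0"
  shows "psi q (- w) = rr_G (q ^ 2) * rr_G (q ^ 3) / (rr_G q * rr_G (q ^ 6))"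
    "phi q (- w) = rr_H (q ^ 2) * rr_H (q ^ 3) / (rr_H q * rr_H (q ^ 6))"
  using theta_cube_roots_minus_rr [OF q0 q1 assms] by (simp_all add: psi_def phi_def mult.commute)

lemma psi_phi_i:
  "psi q \<i> = rr_G (q ^ 2) / rr_G (q ^ 4)" "phi q \<i> = rr_H (q ^ 2) / rr_H (q ^ 4)"
  using theta_i_rr [OF q0 q1] by (simp_all add: psi_def phi_def mult.commute)

lemma psi_phi_quarter:
  assumes s: "s ^ 2 = q ^ 5"
  shows "psi q (\<i> * s) = - (q / (\<i> * s)) * (rr_H q * rr_G (q ^ 4) / (rr_G (q ^ 2) * rr_H (q ^ 2)))"
    "phi q (\<i> * s) = - (q ^ 2 / (\<i> * s)) * (rr_G q * rr_H (q ^ 4) / (rr_G (q ^ 2) * rr_H (q ^ 2)))"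
proof -
  have p: "norm (q ^ 5) < 1" using q1 by (rule norm_power_less_one) simp
  have "theta (- (q ^ 5 * q ^ 2)) (q ^ 10) = theta (- (q ^ 3)) (q ^ 10)"
    using theta_reflect_power(2) [OF q0 q1, of 7 3 10] by (simp flip: power_add)
  then show "psi q (\<i> * s) = - (q / (\<i> * s)) * (rr_H q * rr_G (q ^ 4) / (rr_G (q ^ 2) * rr_H (q ^ 2)))"
    using theta_pair_quarter [OF p s _ q0] theta_minus_10(2) [OF q0 q1] q0
    by (simp add: psi_def flip: power_mult)
  have "theta (- (q ^ 5 * (q ^ 2) ^ 2)) (q ^ 10) = theta (- q) (q ^ 10)"
    using theta_reflect_power(2) [OF q0 q1, of 9 1 10] by (simp flip: power_add power_mult)
  then show "phi q (\<i> * s) = - (q ^ 2 / (\<i> * s)) * (rr_G q * rr_H (q ^ 4) / (rr_G (q ^ 2) * rr_H (q ^ 2)))"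
    using theta_pair_quarter [OF p s, of "q ^ 2"] theta_minus_10(1) [OF q0 q1] q0
    by (simp add: phi_def flip: power_mult)
qed

lemma theta_three_term_i:
  assumes "y \<noteq> 0"
  shows "phi q \<i> * psi q y - psi q \<i> * phi q y
    = - (q / y) * theta (- (y ^ 2)) (q ^ 10) * (theta q (q ^ 5) * theta (q ^ 2) (q ^ 5))"
proof -
  have p: "norm (q ^ 5) < 1" using q1 by (rule norm_power_less_one) simp
  show ?thesis
    using theta_three_term [of q \<i> y] theta_pair_i [OF p, of y] assms q0 q1 by (simp flip: power_mult)
qed

text \<open>The relation at $z = i s$ with $s^2 = q^5$, cleared of $s$.\<close>

lemma theta_three_term_quarter:
  assumes "y \<noteq> 0"
  shows "rr_H q * rr_G (q ^ 4) * phi q y - q * (rr_G q * rr_H (q ^ 4)) * psi q y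
    = rr_G (q ^ 2) * rr_H (q ^ 2) * theta (- (q ^ 5 * y ^ 2)) (q ^ 10)
      * (theta q (q ^ 5) * theta (q ^ 2) (q ^ 5))"
proof -
  have p: "norm (q ^ 5) < 1" using q1 by (rule norm_power_less_one) simp
  define s where "s = csqrt (q ^ 5)"
  define z where "z = \<i> * s"
  have s: "s ^ 2 = q ^ 5" by (simp add: s_def)
  then have z0: "z \<noteq> 0" using q0 by (auto simp: z_def)
  define GH where "GH = rr_G (q ^ 2) * rr_H (q ^ 2)"
  have GH: "GH \<noteq> 0" using rr_all_nonzero [OF q0 q1] by (simp add: GH_def)
  define A where "A = rr_H q * rr_G (q ^ 4)"
  define B where "B = rr_G q * rr_H (q ^ 4)"
  define T where "T = theta (- (q ^ 5 * y ^ 2)) (q ^ 10)"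
  define C where "C = theta q (q ^ 5) * theta (q ^ 2) (q ^ 5)"
  have "- (q ^ 2 / z) * (B / GH) * psi q y - - (q / z) * (A / GH) * phi q y
      = - (q / y) * (- (y / z) * T) * C"
    using theta_three_term [of q z y] theta_pair_quarter [OF p s, of y] psi_phi_quarter [OF s]
      assms q0 q1 z0
    unfolding z_def [symmetric] A_def [symmetric] B_def [symmetric] GH_def [symmetric] C_def [symmetric]
    by (simp add: T_def flip: power_mult)
  moreover have "- (q ^ 2 / z) * (B / GH) * psi q y - - (q / z) * (A / GH) * phi q y
      = q / z * ((A * phi q y - q * B * psi q y) / GH)"
    by (simp add: power2_eq_square algebra_simps diff_divide_distrib)
  moreover have "- (q / y) * (- (y / z) * T) * C = q / z * (T * C)"
    using assms by simp
  ultimately have "q / z * ((A * phi q y - q * B * psi q y) / GH) = q / z * (T * C)"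
    by simp
  then have "(A * phi q y - q * B * psi q y) / GH = T * C"
    using q0 z0 by (metis divide_eq_0_iff mult_left_cancel)
  then have "A * phi q y - q * B * psi q y = GH * T * C"
    using GH by (simp add: divide_eq_eq mult_ac)
  then show ?thesis
    unfolding A_def B_def GH_def C_def T_def .
qed

end

lemma cube_root_unity_ex: "\<exists>w::complex. w ^ 2 + w + 1 = 0"
proof
  have "(csqrt (- 3)) ^ 2 = (- 3 :: complex)" by (rule power2_csqrt)
  then show "((csqrt (- 3) - 1) / 2) ^ 2 + (csqrt (- 3) - 1) / 2 + 1 = 0"
    by (simp add: power2_eq_square field_simps)
qed

lemma cube_root_unity_props:
  fixes w :: complex
  assumes "w ^ 2 + w + 1 = 0"
  shows "w ^ 3 = 1" "w \<noteq> 0" "w \<noteq> 1" "norm w = 1" "1 / w = w ^ 2"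
proof -
  show w3: "w ^ 3 = 1" using assms by algebra
  then have "norm w ^ 3 = 1" by (metis norm_power norm_one)
  then show "norm w = 1" using power_eq_imp_eq_base [of "norm w" 3 1] by simp
  show w0: "w \<noteq> 0" and "w \<noteq> 1" using assms by auto
  have "w ^ 2 * w = 1" using w3 by (simp add: eval_nat_numeral mult_ac)
  then show "1 / w = w ^ 2" using w0 by (simp add: divide_eq_eq)
qed

context
  fixes q :: complex
  assumes q0: "q \<noteq> 0" and q1: "norm q < 1"
begin

text \<open>Up to a nonzero monomial the difference of the two sides is the left-hand side of the
  three-term relation at (z, y) = (w, 1). Its right-hand side is nonzero because w and 1/w have
  modulus 1 and differ from 1.\<close>

lemma rr_cubic_nonzero: "rr_H q ^ 3 * rr_G (q ^ 3) \<noteq> rr_G q ^ 3 * rr_H (q ^ 3)"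
proof
  obtain w :: complex where w: "w ^ 2 + w + 1 = 0" using cube_root_unity_ex by blast
  note w' = cube_root_unity_props [OF w]
  have p: "norm (q ^ 5) < 1" using q1 by (rule norm_power_less_one) simp
  have "theta w (q ^ 5) \<noteq> 0" "theta (1 / w) (q ^ 5) \<noteq> 0"
    using theta_nonzero [OF p, of w] theta_nonzero [OF p, of "1 / w"] p w'(2-4)
    by (simp_all add: norm_divide)
  moreover have "theta q (q ^ 5) \<noteq> 0" "theta (q ^ 2) (q ^ 5) \<noteq> 0"
    using theta_power_nonzero(1) [OF q0 q1, of 1 5] theta_power_nonzero(1) [OF q0 q1, of 2 5] by auto
  ultimately have "phi q w * psi q 1 - psi q w * phi q 1 \<noteq> 0"
    using theta_three_term [of q w 1] q0 q1 w' by auto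
  then have ne: "rr_H q / rr_H (q ^ 3) * (1 / rr_G q ^ 2) \<noteq> rr_G q / rr_G (q ^ 3) * (1 / rr_H q ^ 2)"
    unfolding psi_phi_1 [OF q0 q1] psi_phi_cube_root [OF q0 q1 w] by simp
  assume "rr_H q ^ 3 * rr_G (q ^ 3) = rr_G q ^ 3 * rr_H (q ^ 3)"
  then have "rr_H q / rr_H (q ^ 3) * (1 / rr_G q ^ 2) = rr_G q / rr_G (q ^ 3) * (1 / rr_H q ^ 2)"
    using rr_all_nonzero [OF q0 q1]
    by (simp add: field_simps power3_eq_cube [of "rr_G q"] power3_eq_cube [of "rr_H q"]
        power2_eq_square [of "rr_G q"] power2_eq_square [of "rr_H q"])
  with ne show False by simp
qed

text \<open>With Q = q^3 the argument q^5 is Q^(5/3). Reflection and inversion move the exponents to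
  {2, 7} for \<open>psi\<close> and {1, 4} for \<open>phi\<close>, the two pairs known modulo
  15.\<close>

lemma psi_phi_third:
  "psi (q ^ 3) (q ^ 5) = - (rr_G (q ^ 3) / rr_H q) / q ^ 2"
  "phi (q ^ 3) (q ^ 5) = rr_H (q ^ 3) / rr_G q"
  "psi (q ^ 3) (- (q ^ 5)) = rr_G (q ^ 6) * rr_H q / (rr_H (q ^ 2) * rr_G (q ^ 3)) / q ^ 2"
  "phi (q ^ 3) (- (q ^ 5)) = rr_H (q ^ 6) * rr_G q / (rr_G (q ^ 2) * rr_H (q ^ 3))"
proof -
  have p: "norm (q ^ 15) < 1" "q ^ 15 \<noteq> 0" using q0 q1 by (auto intro: norm_power_less_one)
  have e: "q ^ 3 / q ^ 5 = 1 / q ^ 2" "q ^ 6 / q ^ 5 = q"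
    using q0 by (simp_all add: eval_nat_numeral)
  have inv: "theta (1 / q ^ 2) (q ^ 15) = - theta (q ^ 2) (q ^ 15) / q ^ 2"
    "theta (- (1 / q ^ 2)) (q ^ 15) = theta (- (q ^ 2)) (q ^ 15) / q ^ 2"
    using theta_inverse [OF p, of "q ^ 2"] theta_inverse [OF p, of "- (q ^ 2)"] q0 by auto
  note refl = theta_reflect_power [OF q0 q1, of 8 7 15] theta_reflect_power [OF q0 q1, of 11 4 15]
  show "psi (q ^ 3) (q ^ 5) = - (rr_G (q ^ 3) / rr_H q) / q ^ 2"
    "psi (q ^ 3) (- (q ^ 5)) = rr_G (q ^ 6) * rr_H q / (rr_H (q ^ 2) * rr_G (q ^ 3)) / q ^ 2"
    using theta_15(2) [OF q0 q1] theta_minus_15(2) [OF q0 q1]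
    by (simp_all add: psi_def e inv refl mult.commute flip: power_mult power_add)
  show "phi (q ^ 3) (q ^ 5) = rr_H (q ^ 3) / rr_G q"
    "phi (q ^ 3) (- (q ^ 5)) = rr_H (q ^ 6) * rr_G q / (rr_G (q ^ 2) * rr_H (q ^ 3))"
    using theta_15(1) [OF q0 q1] theta_minus_15(1) [OF q0 q1]
    by (simp_all add: phi_def e refl mult.commute flip: power_mult power_add) 
qed

text \<open>With Q = q^6 the argument q^5 is Q^(5/6). The exponents become {1, 11} for
  \<open>psi\<close> and {7, 13} for \<open>phi\<close>, the two pairs known modulo 30.\<close>

lemma psi_phi_sixth:
  "psi (q ^ 6) (q ^ 5) = rr_H (q ^ 2) * rr_H (q ^ 3) / (rr_G q * rr_G (q ^ 6))"
  "phi (q ^ 6) (q ^ 5) = rr_G (q ^ 2) * rr_G (q ^ 3) / (rr_H q * rr_H (q ^ 6))"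
  "psi (q ^ 6) (- (q ^ 5)) = rr_H (q ^ 4) * rr_H (q ^ 6) * rr_G q * rr_G (q ^ 6)
        / (rr_G (q ^ 2) * rr_G (q ^ 12) * rr_H (q ^ 2) * rr_H (q ^ 3))"
  "phi (q ^ 6) (- (q ^ 5)) = rr_G (q ^ 4) * rr_G (q ^ 6) * rr_H q * rr_H (q ^ 6)
        / (rr_H (q ^ 2) * rr_H (q ^ 12) * rr_G (q ^ 2) * rr_G (q ^ 3))"
proof -
  have e: "q ^ 6 / q ^ 5 = q" "q ^ 12 / q ^ 5 = q ^ 7"
    using q0 by (simp_all add: eval_nat_numeral)
  note refl = theta_reflect_power [OF q0 q1, of 17 13 30]
  show "psi (q ^ 6) (q ^ 5) = rr_H (q ^ 2) * rr_H (q ^ 3) / (rr_G q * rr_G (q ^ 6))"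
    "psi (q ^ 6) (- (q ^ 5)) = rr_H (q ^ 4) * rr_H (q ^ 6) * rr_G q * rr_G (q ^ 6)
        / (rr_G (q ^ 2) * rr_G (q ^ 12) * rr_H (q ^ 2) * rr_H (q ^ 3))"
    using theta_30(1) [OF q0 q1] theta_minus_30(1) [OF q0 q1]
    by (simp_all add: psi_def e mult.commute flip: power_mult power_add)
  show "phi (q ^ 6) (q ^ 5) = rr_G (q ^ 2) * rr_G (q ^ 3) / (rr_H q * rr_H (q ^ 6))"
    "phi (q ^ 6) (- (q ^ 5)) = rr_G (q ^ 4) * rr_G (q ^ 6) * rr_H q * rr_H (q ^ 6)
        / (rr_H (q ^ 2) * rr_H (q ^ 12) * rr_G (q ^ 2) * rr_G (q ^ 3))"
    using theta_30(2) [OF q0 q1] theta_minus_30(2) [OF q0 q1]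
    by (simp_all add: phi_def e refl mult.commute flip: power_mult power_add)
qed

end

section \<open>Two-term combinations at levels 12 and 24\<close>

context
  fixes q :: complex
  assumes q0: "q \<noteq> 0" and q1: "norm q < 1"
begin

text \<open>Denominator and numerator of the first identity: Q = q^3 and y = q^5, with z = i and z =
  i Q^(5/2) respectively. Both carry the same constant \<open>C\<close>.\<close>

lemma level12_plus:
  defines "C \<equiv> theta (q ^ 3) (q ^ 15) * theta (q ^ 6) (q ^ 15)"
  shows "rr_G q * rr_G (q ^ 3) * rr_H (q ^ 6) * rr_G (q ^ 12)
      + q ^ 2 * rr_H q * rr_H (q ^ 3) * rr_G (q ^ 6) * rr_H (q ^ 12)
      = rr_G q * rr_H q * rr_G (q ^ 12) * rr_H (q ^ 12) * theta (- (q ^ 10)) (q ^ 30) * C"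
    "rr_H q * rr_H (q ^ 3) ^ 2 * rr_G (q ^ 12) + q * rr_G q * rr_G (q ^ 3) ^ 2 * rr_H (q ^ 12)
      = rr_G q * rr_H q * rr_G (q ^ 6) * rr_H (q ^ 6) * theta (- (q ^ 5)) (q ^ 30) * C"
proof -
  have Q: "q ^ 3 \<noteq> 0" "norm (q ^ 3) < 1" using q0 q1 by (auto intro: norm_power_less_one)
  define T5 where "T5 = theta (- (q ^ 5)) (q ^ 30)"
  define T10 where "T10 = theta (- (q ^ 10)) (q ^ 30)"
  note nz = rr_all_nonzero [OF q0 q1]
  have "rr_H (q ^ 6) / rr_H (q ^ 12) * (- (rr_G (q ^ 3) / rr_H q) / q ^ 2)
      - rr_G (q ^ 6) / rr_G (q ^ 12) * (rr_H (q ^ 3) / rr_G q) = - (q ^ 3 / q ^ 5) * T10 * C"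
    using theta_three_term_i [OF Q, of "q ^ 5"] psi_phi_i [OF Q] psi_phi_third [OF q0 q1] q0
    by (simp add: C_def T10_def flip: power_mult)
  also have "q ^ 3 / q ^ 5 = 1 / q ^ 2" using q0 by (simp add: eval_nat_numeral)
  finally show "rr_G q * rr_G (q ^ 3) * rr_H (q ^ 6) * rr_G (q ^ 12)
      + q ^ 2 * rr_H q * rr_H (q ^ 3) * rr_G (q ^ 6) * rr_H (q ^ 12)
      = rr_G q * rr_H q * rr_G (q ^ 12) * rr_H (q ^ 12) * theta (- (q ^ 10)) (q ^ 30) * C"
    using q0 nz unfolding T10_def [symmetric] by (simp add: divide_simps) (simp add: algebra_simps)
  \<comment> \<open>The relation yields exponent 25; reflection modulo 30 turns it into 5.\<close>
  have "theta (- (q ^ 15 * q ^ 10)) (q ^ 30) = T5"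
    using theta_reflect_power(2) [OF q0 q1, of 25 5 30] by (simp add: T5_def flip: power_add)
  then have F: "rr_H (q ^ 3) * rr_G (q ^ 12) * (rr_H (q ^ 3) / rr_G q)
      - q ^ 3 * (rr_G (q ^ 3) * rr_H (q ^ 12)) * (- (rr_G (q ^ 3) / rr_H q) / q ^ 2)
    = rr_G (q ^ 6) * rr_H (q ^ 6) * T5 * C"
    using theta_three_term_quarter [OF Q, of "q ^ 5"] psi_phi_third [OF q0 q1] q0
    by (simp add: C_def flip: power_mult)
  have e: "q ^ 3 * x * (- y / q ^ 2) = - (q * x * y)" for x y
    using q0 by (simp add: eval_nat_numeral)
  have "rr_H (q ^ 3) * rr_G (q ^ 12) * (rr_H (q ^ 3) / rr_G q)
      + q * (rr_G (q ^ 3) * rr_H (q ^ 12)) * (rr_G (q ^ 3) / rr_H q)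
    = rr_G (q ^ 6) * rr_H (q ^ 6) * T5 * C"
    using F unfolding e by simp
  then show "rr_H q * rr_H (q ^ 3) ^ 2 * rr_G (q ^ 12) + q * rr_G q * rr_G (q ^ 3) ^ 2 * rr_H (q ^ 12)
      = rr_G q * rr_H q * rr_G (q ^ 6) * rr_H (q ^ 6) * theta (- (q ^ 5)) (q ^ 30) * C"
    using nz unfolding T5_def [symmetric]
    by (simp add: divide_simps) (simp add: algebra_simps power2_eq_square [of "rr_H (q ^ 3)"]
        power2_eq_square [of "rr_G (q ^ 3)"])
qed

text \<open>The same two relations at y = -q^5. These binomials appear in the second identity once
  \<open>V\<close> is eliminated in favour of \<open>U\<close>.\<close>

lemma level12_minus:
  defines "C \<equiv> theta (q ^ 3) (q ^ 15) * theta (q ^ 6) (q ^ 15)"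
  shows "rr_G (q ^ 6) * rr_H (q ^ 6) * (rr_H q * rr_H (q ^ 3) * rr_G (q ^ 2) * rr_G (q ^ 12)
      - q ^ 2 * rr_G q * rr_G (q ^ 3) * rr_H (q ^ 2) * rr_H (q ^ 12))
      = rr_G (q ^ 2) * rr_H (q ^ 2) * rr_G (q ^ 3) * rr_H (q ^ 3) * rr_G (q ^ 12) * rr_H (q ^ 12)
        * theta (- (q ^ 10)) (q ^ 30) * C"
    "rr_G q * rr_H (q ^ 2) * rr_H (q ^ 6) * rr_G (q ^ 12) - q * rr_H q * rr_G (q ^ 2) * rr_G (q ^ 6) * rr_H (q ^ 12)
      = rr_G (q ^ 2) * rr_H (q ^ 2) * rr_G (q ^ 6) * rr_H (q ^ 6) * theta (- (q ^ 5)) (q ^ 30) * C"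
proof -
  have Q: "q ^ 3 \<noteq> 0" "norm (q ^ 3) < 1" using q0 q1 by (auto intro: norm_power_less_one)
  define T5 where "T5 = theta (- (q ^ 5)) (q ^ 30)"
  define T10 where "T10 = theta (- (q ^ 10)) (q ^ 30)"
  note nz = rr_all_nonzero [OF q0 q1]
  have "rr_H (q ^ 6) / rr_H (q ^ 12) * (rr_G (q ^ 6) * rr_H q / (rr_H (q ^ 2) * rr_G (q ^ 3)) / q ^ 2)
      - rr_G (q ^ 6) / rr_G (q ^ 12) * (rr_H (q ^ 6) * rr_G q / (rr_G (q ^ 2) * rr_H (q ^ 3)))
    = (q ^ 3 / q ^ 5) * T10 * C"
    using theta_three_term_i [OF Q, of "- (q ^ 5)"] psi_phi_i [OF Q] psi_phi_third [OF q0 q1] q0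
    by (simp add: C_def T10_def flip: power_mult)
  also have "q ^ 3 / q ^ 5 = 1 / q ^ 2" using q0 by (simp add: eval_nat_numeral)
  finally show "rr_G (q ^ 6) * rr_H (q ^ 6) * (rr_H q * rr_H (q ^ 3) * rr_G (q ^ 2) * rr_G (q ^ 12)
      - q ^ 2 * rr_G q * rr_G (q ^ 3) * rr_H (q ^ 2) * rr_H (q ^ 12))
      = rr_G (q ^ 2) * rr_H (q ^ 2) * rr_G (q ^ 3) * rr_H (q ^ 3) * rr_G (q ^ 12) * rr_H (q ^ 12)
        * theta (- (q ^ 10)) (q ^ 30) * C"
    using q0 nz unfolding T10_def [symmetric] by (simp add: divide_simps) (simp add: algebra_simps)
  have "theta (- (q ^ 15 * q ^ 10)) (q ^ 30) = T5"
    using theta_reflect_power(2) [OF q0 q1, of 25 5 30] by (simp add: T5_def flip: power_add)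
  then have F: "rr_H (q ^ 3) * rr_G (q ^ 12) * (rr_H (q ^ 6) * rr_G q / (rr_G (q ^ 2) * rr_H (q ^ 3)))
      - q ^ 3 * (rr_G (q ^ 3) * rr_H (q ^ 12)) * (rr_G (q ^ 6) * rr_H q / (rr_H (q ^ 2) * rr_G (q ^ 3)) / q ^ 2)
    = rr_G (q ^ 6) * rr_H (q ^ 6) * T5 * C"
    using theta_three_term_quarter [OF Q, of "- (q ^ 5)"] psi_phi_third [OF q0 q1] q0
    by (simp add: C_def flip: power_mult)
  have e: "q ^ 3 * x * (y / q ^ 2) = q * x * y" for x y
    using q0 by (simp add: eval_nat_numeral)
  have "rr_H (q ^ 3) * rr_G (q ^ 12) * (rr_H (q ^ 6) * rr_G q / (rr_G (q ^ 2) * rr_H (q ^ 3)))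
      - q * (rr_G (q ^ 3) * rr_H (q ^ 12)) * (rr_G (q ^ 6) * rr_H q / (rr_H (q ^ 2) * rr_G (q ^ 3)))
    = rr_G (q ^ 6) * rr_H (q ^ 6) * T5 * C"
    using F unfolding e by simp
  then show "rr_G q * rr_H (q ^ 2) * rr_H (q ^ 6) * rr_G (q ^ 12) - q * rr_H q * rr_G (q ^ 2) * rr_G (q ^ 6) * rr_H (q ^ 12)
      = rr_G (q ^ 2) * rr_H (q ^ 2) * rr_G (q ^ 6) * rr_H (q ^ 6) * theta (- (q ^ 5)) (q ^ 30) * C"
    using nz unfolding T5_def [symmetric] by (simp add: divide_simps) (simp add: algebra_simps)
qed

end

context
  fixes q :: complex
  assumes q0: "q \<noteq> 0" and q1: "norm q < 1"
begin

text \<open>Q = q^6 and y = q^5, for the third identity. Here z = i gives the numerator and z = i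
  Q^(5/2) the denominator, the reverse of level 12. The factor q is q^6 / q^5, that is Q /
  y.\<close>

lemma level24_plus:
  defines "C \<equiv> theta (q ^ 6) (q ^ 30) * theta (q ^ 12) (q ^ 30)"
  shows "rr_G q * rr_G (q ^ 2) * rr_G (q ^ 3) * rr_G (q ^ 6) * rr_G (q ^ 12) * rr_H (q ^ 24)
      - rr_H q * rr_H (q ^ 2) * rr_H (q ^ 3) * rr_H (q ^ 6) * rr_H (q ^ 12) * rr_G (q ^ 24)
      = q * (rr_G q * rr_H q * rr_G (q ^ 6) * rr_H (q ^ 6) * rr_G (q ^ 24) * rr_H (q ^ 24))
        * theta (- (q ^ 10)) (q ^ 60) * C"
    "rr_G q * rr_G (q ^ 2) * rr_G (q ^ 3) * rr_G (q ^ 24)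
      - q ^ 6 * rr_H q * rr_H (q ^ 2) * rr_H (q ^ 3) * rr_H (q ^ 24)
      = rr_G q * rr_H q * rr_G (q ^ 12) * rr_H (q ^ 12) * theta (- (q ^ 20)) (q ^ 60) * C"
proof -
  have Q: "q ^ 6 \<noteq> 0" "norm (q ^ 6) < 1" using q0 q1 by (auto intro: norm_power_less_one)
  define T10 where "T10 = theta (- (q ^ 10)) (q ^ 60)"
  define T20 where "T20 = theta (- (q ^ 20)) (q ^ 60)"
  note nz = rr_all_nonzero [OF q0 q1]
  have "rr_H (q ^ 12) / rr_H (q ^ 24) * (rr_H (q ^ 2) * rr_H (q ^ 3) / (rr_G q * rr_G (q ^ 6)))
      - rr_G (q ^ 12) / rr_G (q ^ 24) * (rr_G (q ^ 2) * rr_G (q ^ 3) / (rr_H q * rr_H (q ^ 6)))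
    = - (q ^ 6 / q ^ 5) * T10 * C"
    using theta_three_term_i [OF Q, of "q ^ 5"] psi_phi_i [OF Q] psi_phi_sixth [OF q0 q1] q0
    by (simp add: C_def T10_def flip: power_mult)
  also have "q ^ 6 / q ^ 5 = q" using q0 by (simp add: eval_nat_numeral)
  finally show "rr_G q * rr_G (q ^ 2) * rr_G (q ^ 3) * rr_G (q ^ 6) * rr_G (q ^ 12) * rr_H (q ^ 24)
      - rr_H q * rr_H (q ^ 2) * rr_H (q ^ 3) * rr_H (q ^ 6) * rr_H (q ^ 12) * rr_G (q ^ 24)
      = q * (rr_G q * rr_H q * rr_G (q ^ 6) * rr_H (q ^ 6) * rr_G (q ^ 24) * rr_H (q ^ 24))
        * theta (- (q ^ 10)) (q ^ 60) * C"
    using q0 nz unfolding T10_def [symmetric] by (simp add: divide_simps) (simp add: algebra_simps)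
  have "theta (- (q ^ 30 * q ^ 10)) (q ^ 60) = T20"
    using theta_reflect_power(2) [OF q0 q1, of 40 20 60] by (simp add: T20_def flip: power_add)
  then have "rr_H (q ^ 6) * rr_G (q ^ 24) * (rr_G (q ^ 2) * rr_G (q ^ 3) / (rr_H q * rr_H (q ^ 6)))
      - q ^ 6 * (rr_G (q ^ 6) * rr_H (q ^ 24)) * (rr_H (q ^ 2) * rr_H (q ^ 3) / (rr_G q * rr_G (q ^ 6)))
    = rr_G (q ^ 12) * rr_H (q ^ 12) * T20 * C"
    using theta_three_term_quarter [OF Q, of "q ^ 5"] psi_phi_sixth [OF q0 q1] q0
    by (simp add: C_def flip: power_mult)
  then show "rr_G q * rr_G (q ^ 2) * rr_G (q ^ 3) * rr_G (q ^ 24)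
      - q ^ 6 * rr_H q * rr_H (q ^ 2) * rr_H (q ^ 3) * rr_H (q ^ 24)
      = rr_G q * rr_H q * rr_G (q ^ 12) * rr_H (q ^ 12) * theta (- (q ^ 20)) (q ^ 60) * C"
    using nz unfolding T20_def [symmetric] by (simp add: divide_simps) (simp add: algebra_simps)
qed

text \<open>Q = q^6 and y = -q^5, for the fourth identity after \<open>Y\<close> is eliminated in
  favour of \<open>Z\<close>.\<close>

lemma level24_minus:
  defines "C \<equiv> theta (q ^ 6) (q ^ 30) * theta (q ^ 12) (q ^ 30)"
  shows "rr_G (q ^ 6) * rr_H (q ^ 6)
      * (rr_G q * rr_G (q ^ 3) * rr_H (q ^ 4) * rr_H (q ^ 12) ^ 2 * rr_G (q ^ 24)
        - rr_H q * rr_H (q ^ 3) * rr_G (q ^ 4) * rr_G (q ^ 12) ^ 2 * rr_H (q ^ 24))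
      = q * (rr_G (q ^ 2) * rr_H (q ^ 2) * rr_G (q ^ 3) * rr_H (q ^ 3) * rr_G (q ^ 12) * rr_H (q ^ 12)
          * rr_G (q ^ 24) * rr_H (q ^ 24)) * theta (- (q ^ 10)) (q ^ 60) * C"
    "rr_G (q ^ 6) * rr_H (q ^ 6)
      * (rr_H q * rr_H (q ^ 3) * rr_H (q ^ 6) * rr_G (q ^ 4) * rr_G (q ^ 12) * rr_G (q ^ 24)
        - q ^ 6 * rr_G q * rr_G (q ^ 3) * rr_G (q ^ 6) * rr_H (q ^ 4) * rr_H (q ^ 12) * rr_H (q ^ 24))
      = rr_G (q ^ 2) * rr_H (q ^ 2) * rr_G (q ^ 3) * rr_H (q ^ 3) * rr_G (q ^ 12) ^ 2 * rr_H (q ^ 12) ^ 2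
          * theta (- (q ^ 20)) (q ^ 60) * C"
proof -
  have Q: "q ^ 6 \<noteq> 0" "norm (q ^ 6) < 1" using q0 q1 by (auto intro: norm_power_less_one)
  define T10 where "T10 = theta (- (q ^ 10)) (q ^ 60)"
  define T20 where "T20 = theta (- (q ^ 20)) (q ^ 60)"
  note nz = rr_all_nonzero [OF q0 q1]
  have "rr_H (q ^ 12) / rr_H (q ^ 24) * (rr_H (q ^ 4) * rr_H (q ^ 6) * rr_G q * rr_G (q ^ 6)
        / (rr_G (q ^ 2) * rr_G (q ^ 12) * rr_H (q ^ 2) * rr_H (q ^ 3)))
      - rr_G (q ^ 12) / rr_G (q ^ 24) * (rr_G (q ^ 4) * rr_G (q ^ 6) * rr_H q * rr_H (q ^ 6)
        / (rr_H (q ^ 2) * rr_H (q ^ 12) * rr_G (q ^ 2) * rr_G (q ^ 3)))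
    = (q ^ 6 / q ^ 5) * T10 * C"
    using theta_three_term_i [OF Q, of "- (q ^ 5)"] psi_phi_i [OF Q] psi_phi_sixth [OF q0 q1] q0
    by (simp add: C_def T10_def flip: power_mult)
  also have "q ^ 6 / q ^ 5 = q" using q0 by (simp add: eval_nat_numeral)
  finally show "rr_G (q ^ 6) * rr_H (q ^ 6)
      * (rr_G q * rr_G (q ^ 3) * rr_H (q ^ 4) * rr_H (q ^ 12) ^ 2 * rr_G (q ^ 24)
        - rr_H q * rr_H (q ^ 3) * rr_G (q ^ 4) * rr_G (q ^ 12) ^ 2 * rr_H (q ^ 24))
      = q * (rr_G (q ^ 2) * rr_H (q ^ 2) * rr_G (q ^ 3) * rr_H (q ^ 3) * rr_G (q ^ 12) * rr_H (q ^ 12)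
          * rr_G (q ^ 24) * rr_H (q ^ 24)) * theta (- (q ^ 10)) (q ^ 60) * C"
    using q0 nz unfolding T10_def [symmetric]
    by (simp add: divide_simps) (simp add: algebra_simps power2_eq_square [of "rr_H (q ^ 12)"]
        power2_eq_square [of "rr_G (q ^ 12)"])
  have "theta (- (q ^ 30 * q ^ 10)) (q ^ 60) = T20"
    using theta_reflect_power(2) [OF q0 q1, of 40 20 60] by (simp add: T20_def flip: power_add)
  then have "rr_H (q ^ 6) * rr_G (q ^ 24) * (rr_G (q ^ 4) * rr_G (q ^ 6) * rr_H q * rr_H (q ^ 6)
        / (rr_H (q ^ 2) * rr_H (q ^ 12) * rr_G (q ^ 2) * rr_G (q ^ 3)))
      - q ^ 6 * (rr_G (q ^ 6) * rr_H (q ^ 24)) * (rr_H (q ^ 4) * rr_H (q ^ 6) * rr_G q * rr_G (q ^ 6)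
        / (rr_G (q ^ 2) * rr_G (q ^ 12) * rr_H (q ^ 2) * rr_H (q ^ 3)))
    = rr_G (q ^ 12) * rr_H (q ^ 12) * T20 * C"
    using theta_three_term_quarter [OF Q, of "- (q ^ 5)"] psi_phi_sixth [OF q0 q1] q0
    by (simp add: C_def flip: power_mult)
  then show "rr_G (q ^ 6) * rr_H (q ^ 6)
      * (rr_H q * rr_H (q ^ 3) * rr_H (q ^ 6) * rr_G (q ^ 4) * rr_G (q ^ 12) * rr_G (q ^ 24)
        - q ^ 6 * rr_G q * rr_G (q ^ 3) * rr_G (q ^ 6) * rr_H (q ^ 4) * rr_H (q ^ 12) * rr_H (q ^ 24))
      = rr_G (q ^ 2) * rr_H (q ^ 2) * rr_G (q ^ 3) * rr_H (q ^ 3) * rr_G (q ^ 12) ^ 2 * rr_H (q ^ 12) ^ 2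
          * theta (- (q ^ 20)) (q ^ 60) * C"
    using nz unfolding T20_def [symmetric]
    by (simp add: divide_simps) (simp add: algebra_simps power2_eq_square [of "rr_H (q ^ 12)"]
        power2_eq_square [of "rr_G (q ^ 12)"] power2_eq_square [of "rr_G (q ^ 6)"] power2_eq_square [of "rr_H (q ^ 6)"])
qed

text \<open>At (z, y) = (w, -1) and (-w, 1) the theta product is in both cases theta(-w)
  theta(-1/w), while the prefactors -Q/y are opposite. The two left-hand sides therefore add up to
  0; clearing denominators gives the claim.\<close>

lemma relation_VU:
  "rr_G q ^ 3 * rr_H q ^ 3 * rr_G (q ^ 6) * rr_H (q ^ 6)
      * (rr_H (q ^ 2) ^ 2 * rr_G q * rr_G (q ^ 3) - rr_H q * rr_H (q ^ 3) * rr_G (q ^ 2) ^ 2)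
    = rr_G (q ^ 3) * rr_H (q ^ 3) * rr_G (q ^ 2) ^ 2 * rr_H (q ^ 2) ^ 2
      * (rr_G q * rr_G (q ^ 2) * rr_G (q ^ 3) * rr_H (q ^ 6) - rr_H q * rr_H (q ^ 2) * rr_H (q ^ 3) * rr_G (q ^ 6))"
proof -
  obtain w :: complex where w: "w ^ 2 + w + 1 = 0" using cube_root_unity_ex by blast
  note w' = cube_root_unity_props [OF w]
  have "phi q w * psi q (- 1) - psi q w * phi q (- 1) + (phi q (- w) * psi q 1 - psi q (- w) * phi q 1) = 0"
    using theta_three_term [of q w "- 1"] theta_three_term [of q "- w" 1] q0 q1 w'(2) by simp
  then have "rr_H q / rr_H (q ^ 3) * (rr_G q / rr_G (q ^ 2)) ^ 2 - rr_G q / rr_G (q ^ 3) * (rr_H q / rr_H (q ^ 2)) ^ 2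
    + (rr_H (q ^ 2) * rr_H (q ^ 3) / (rr_H q * rr_H (q ^ 6)) * (1 / rr_G q ^ 2)
       - rr_G (q ^ 2) * rr_G (q ^ 3) / (rr_G q * rr_G (q ^ 6)) * (1 / rr_H q ^ 2)) = 0"
    unfolding psi_phi_1 [OF q0 q1] psi_phi_minus_1 [OF q0 q1] psi_phi_cube_root [OF q0 q1 w]
      psi_phi_minus_cube_root [OF q0 q1 w] .
  moreover define a b c d e f g h where "a = rr_G q" "b = rr_H q" "c = rr_G (q ^ 2)" "d = rr_H (q ^ 2)"
    "e = rr_G (q ^ 3)" "f = rr_H (q ^ 3)" "g = rr_G (q ^ 6)" "h = rr_H (q ^ 6)"
  ultimately have *: "b / f * (a / c) ^ 2 - a / e * (b / d) ^ 2 + (d * f / (b * h) * (1 / a ^ 2) - c * e / (a * g) * (1 / b ^ 2)) = 0"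
    by simp
  have nz: "a \<noteq> 0" "b \<noteq> 0" "c \<noteq> 0" "d \<noteq> 0" "e \<noteq> 0" "f \<noteq> 0" "g \<noteq> 0" "h \<noteq> 0"
    using rr_all_nonzero [OF q0 q1] by (simp_all add: a_b_c_d_e_f_g_h_def)
  have "a ^ 3 * b ^ 3 * g * h * (d ^ 2 * a * e - b * f * c ^ 2) - e * f * c ^ 2 * d ^ 2 * (a * c * e * h - b * d * f * g)
    = a ^ 2 * b ^ 2 * c ^ 2 * d ^ 2 * e * f * g * h
      * (b / f * (a / c) ^ 2 - a / e * (b / d) ^ 2 + (d * f / (b * h) * (1 / a ^ 2) - c * e / (a * g) * (1 / b ^ 2)))"
    using nz by (simp add: field_simps eval_nat_numeral)
  with * show ?thesis unfolding a_b_c_d_e_f_g_h_def by simp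
qed

text \<open>For base q^10 the point q^5 is a half period: reflecting one factor and inverting the
  other brings both to the odd exponent 3 (for \<open>psi\<close>) or 1 (for
  \<open>phi\<close>).\<close>

lemma psi_phi_half:
  assumes "u \<noteq> 0"
  shows "psi (q ^ 2) (u * q ^ 5) = - (theta (u * q ^ 3) (q ^ 10) * theta (q ^ 3 / u) (q ^ 10)) / (u * q ^ 3)"
    "phi (q ^ 2) (u * q ^ 5) = - (theta (u * q) (q ^ 10) * theta (q / u) (q ^ 10)) / (u * q)"
proof -
  have p: "norm (q ^ 10) < 1" "q ^ 10 \<noteq> 0" using q0 q1 by (auto intro: norm_power_less_one)
  have e: "q ^ 2 / (u * q ^ 5) = 1 / (u * q ^ 3)" "q ^ 4 / (u * q ^ 5) = 1 / (u * q)"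
    "q ^ 10 / (q ^ 3 / u) = q ^ 2 * (u * q ^ 5)" "q ^ 10 / (q / u) = q ^ 4 * (u * q ^ 5)"
    using assms q0 by (simp_all add: eval_nat_numeral)
  have b: "(q ^ 2) ^ 5 = q ^ 10" "(q ^ 2) ^ 2 = q ^ 4" by (simp_all flip: power_mult)
  have r: "theta (q ^ 2 * (u * q ^ 5)) (q ^ 10) = theta (q ^ 3 / u) (q ^ 10)"
    "theta (q ^ 4 * (u * q ^ 5)) (q ^ 10) = theta (q / u) (q ^ 10)"
    using theta_reflect [OF p(2), of "q ^ 3 / u"] theta_reflect [OF p(2), of "q / u"] unfolding e .
  have i: "theta (1 / (u * q ^ 3)) (q ^ 10) = - theta (u * q ^ 3) (q ^ 10) / (u * q ^ 3)"
    "theta (1 / (u * q)) (q ^ 10) = - theta (u * q) (q ^ 10) / (u * q)"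
    using theta_inverse [OF p, of "u * q ^ 3"] theta_inverse [OF p, of "u * q"] assms q0 by simp_all
  show "psi (q ^ 2) (u * q ^ 5) = - (theta (u * q ^ 3) (q ^ 10) * theta (q ^ 3 / u) (q ^ 10)) / (u * q ^ 3)"
    unfolding psi_def b e r i by simp
  show "phi (q ^ 2) (u * q ^ 5) = - (theta (u * q) (q ^ 10) * theta (q / u) (q ^ 10)) / (u * q)"
    unfolding phi_def b e r i by simp
qed

text \<open>
  Two instances of the three-term relation, at $(z,y) = (1, u w q^5)$ and $(z,y) = (w, u q^5)$ with
  nome $q^2$, have the same right-hand side up to a factor $w$.
\<close>

lemma relation_half_period:
  fixes u w :: complex
  assumes w: "w ^ 2 + w + 1 = 0" and u: "u ^ 2 = 1"
  shows "theta (u * q ^ 9) (q ^ 30) / theta (u * q ^ 3) (q ^ 10) / rr_H (q ^ 2) ^ 2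
      - q ^ 2 * (theta (u * q ^ 3) (q ^ 30) / theta (u * q) (q ^ 10)) / rr_G (q ^ 2) ^ 2
    = rr_H (q ^ 2) / rr_H (q ^ 6) * theta (u * q ^ 3) (q ^ 10) ^ 2
      - q ^ 2 * (rr_G (q ^ 2) / rr_G (q ^ 6)) * theta (u * q) (q ^ 10) ^ 2"
proof -
  note w' = cube_root_unity_props [OF w]
  have u1: "u = 1 \<or> u = - 1" using u by (simp add: power2_eq_1_iff)
  then have u': "u \<noteq> 0" "u ^ 3 = u" "x / u = u * x" for x by auto
  have p: "norm (q ^ 10) < 1" "q ^ 10 \<noteq> 0" using q0 q1 by (auto intro: norm_power_less_one)
  have Q: "q ^ 2 \<noteq> 0" "norm (q ^ 2) < 1" using q0 q1 by (auto intro: norm_power_less_one)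
  define C where "C = theta (q ^ 2) (q ^ 10) * theta (q ^ 4) (q ^ 10)"
  define s1 where "s1 = theta (u * q) (q ^ 10)"
  define s3 where "s3 = theta (u * q ^ 3) (q ^ 10)"
  define c1 where "c1 = theta (u * w * q) (q ^ 10) * theta (q / (u * w)) (q ^ 10)"
  define c3 where "c3 = theta (u * w * q ^ 3) (q ^ 10) * theta (q ^ 3 / (u * w)) (q ^ 10)"
  define T where "T = theta (u * w * q ^ 5) (q ^ 10)"
  \<comment> \<open>Reflection at the half period exchanges w and 1/w, using u = 1/u. So theta(yz)
    theta(y/z) is T^2 at (w, u q^5), just as it is at (1, u w q^5).\<close>
  have T: "theta (u * q ^ 5 / w) (q ^ 10) = T"
  proof -
    have "q ^ 10 / (u * w * q ^ 5) = u * q ^ 5 / w"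
      using u1 w'(2) q0 by (auto simp: eval_nat_numeral)
    then show ?thesis using theta_reflect [OF p(2), of "u * w * q ^ 5"] by (simp add: T_def)
  qed
  have s_nz: "s1 \<noteq> 0" "s3 \<noteq> 0"
    using u1 theta_power_nonzero [OF q0 q1, of 1 10] theta_power_nonzero [OF q0 q1, of 3 10]
    by (auto simp: s1_def s3_def)
  have uw: "x / (u * w) = u * x / w" for x using u1 by auto
  \<comment> \<open>Triplication, with u^3 = u, removes w: \<open>c1\<close> and \<open>c3\<close>
    become quotients of thetas of bases q^30 and q^10.\<close>
  have cs: "s1 * c1 = theta (u * q ^ 3) (q ^ 30)" "s3 * c3 = theta (u * q ^ 9) (q ^ 30)"
    using theta_mult_cube_roots [OF p(1) w, of "u * q"] theta_mult_cube_roots [OF p(1) w, of "u * q ^ 3"]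
    by (simp_all add: s1_def s3_def c1_def c3_def uw power_mult_distrib u' mult_ac flip: power_mult)
  have "1 / rr_H (q ^ 2) ^ 2 * (- c3 / (u * w * q ^ 3)) - 1 / rr_G (q ^ 2) ^ 2 * (- c1 / (u * w * q))
      = - (q ^ 2 / (u * w * q ^ 5)) * (T * T) * C"
    using theta_three_term [of "q ^ 2" 1 "u * w * q ^ 5"] psi_phi_1 [OF Q] psi_phi_half [of "u * w"] Q q0 u'(1) w'(2)
    by (simp add: C_def T_def c1_def c3_def flip: power_mult)
  moreover have "- (u * w * q ^ 3) * (1 / rr_H (q ^ 2) ^ 2 * (- c3 / (u * w * q ^ 3)) - 1 / rr_G (q ^ 2) ^ 2 * (- c1 / (u * w * q)))
      = c3 / rr_H (q ^ 2) ^ 2 - q ^ 2 * c1 / rr_G (q ^ 2) ^ 2"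
    using q0 u'(1) w'(2) by (simp add: field_simps eval_nat_numeral)
  moreover have "- (u * w * q ^ 3) * (- (q ^ 2 / (u * w * q ^ 5)) * (T * T) * C) = T * T * C"
    using q0 u'(1) w'(2) by (simp add: eval_nat_numeral)
  ultimately have 1: "c3 / rr_H (q ^ 2) ^ 2 - q ^ 2 * c1 / rr_G (q ^ 2) ^ 2 = T * T * C"
    by metis
  have "rr_H (q ^ 2) / rr_H (q ^ 6) * (- (s3 * s3) / (u * q ^ 3)) - rr_G (q ^ 2) / rr_G (q ^ 6) * (- (s1 * s1) / (u * q))
      = - (q ^ 2 / (u * q ^ 5)) * (T * T) * C"
    using theta_three_term [of "q ^ 2" w "u * q ^ 5"] psi_phi_cube_root [OF Q w] psi_phi_half [of u] Q q0 u' w'(2) T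
    by (simp add: C_def T_def s1_def s3_def mult_ac flip: power_mult)
  moreover have "- (u * q ^ 3) * (rr_H (q ^ 2) / rr_H (q ^ 6) * (- (s3 * s3) / (u * q ^ 3)) - rr_G (q ^ 2) / rr_G (q ^ 6) * (- (s1 * s1) / (u * q)))
      = rr_H (q ^ 2) / rr_H (q ^ 6) * s3 ^ 2 - q ^ 2 * (rr_G (q ^ 2) / rr_G (q ^ 6)) * s1 ^ 2"
    using q0 u'(1) by (simp add: field_simps eval_nat_numeral)
  moreover have "- (u * q ^ 3) * (- (q ^ 2 / (u * q ^ 5)) * (T * T) * C) = T * T * C"
    using q0 u'(1) by (simp add: eval_nat_numeral)
  ultimately have 2: "rr_H (q ^ 2) / rr_H (q ^ 6) * s3 ^ 2 - q ^ 2 * (rr_G (q ^ 2) / rr_G (q ^ 6)) * s1 ^ 2 = T * T * C"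
    by metis
  have "c1 = theta (u * q ^ 3) (q ^ 30) / s1" "c3 = theta (u * q ^ 9) (q ^ 30) / s3"
    using s_nz by (simp_all flip: cs)
  then show ?thesis using 1 2 unfolding s1_def [symmetric] s3_def [symmetric] by simp
qed

end

section \<open>Evaluations in terms of chi\<close>

lemma chi_minus: "chi (- q) = qpoch_inf q (q ^ 2)"
  by (simp add: chi_def)

lemma chi_nonzero:
  assumes "norm q < 1"
  shows "chi q \<noteq> 0"
proof -
  have "norm (q ^ 2) < 1" using assms by (rule norm_power_less_one) simp
  moreover have "- q \<noteq> 1"
    using assms by (metis norm_minus_cancel norm_one order_less_irrefl)
  ultimately show ?thesis
    unfolding chi_def using assms by (intro qpoch_inf_nonzero) auto
qed

lemma qpoch_inf_self_nonzero: "norm q < 1 \<Longrightarrow> qpoch_inf q q \<noteq> 0"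
  by (intro qpoch_inf_nonzero) auto

lemma qpoch_inf_self_chi:
  assumes "norm q < 1"
  shows "qpoch_inf q q = chi (- q) * qpoch_inf (q ^ 2) (q ^ 2)"
  using qpoch_inf_residues [OF assms, of 2 q]
  by (simp add: chi_minus numeral_2_eq_2 power2_eq_square)

lemma chi_mult_minus:
  assumes "norm q < 1"
  shows "chi q * chi (- q) = chi (- (q ^ 2))"
  using qpoch_inf_mult_minus [OF norm_power_less_one [OF assms], of 2 q]
  by (simp add: chi_def mult.commute)

text \<open>Euler's identity (-q;q) (q;q^2) = 1: both products (q;q)(-q;q) and (q^2;q^2) are
  compared, and (q^2;q^2) cancels.\<close>

lemma chi_minus_reciprocal:
  assumes "norm q < 1"
  shows "qpoch_inf (- q) q = 1 / chi (- q)"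
proof -
  have "qpoch_inf q q * qpoch_inf (- q) q = qpoch_inf (q ^ 2) (q ^ 2)"
    by (rule qpoch_inf_mult_minus [OF assms])
  moreover have "qpoch_inf q q = chi (- q) * qpoch_inf (q ^ 2) (q ^ 2)"
    by (rule qpoch_inf_self_chi [OF assms])
  ultimately show ?thesis
    using qpoch_inf_self_nonzero [OF assms] chi_nonzero [of "- q"] assms by (auto simp: field_simps)
qed

text \<open>Splitting (-q;q) modulo 3 leaves this theta times (-q^3;q^3); Euler's identity is then
  applied at q and at q^3.\<close>

lemma theta_minus_3:
  assumes "q \<noteq> 0" "norm q < 1"
  shows "theta (- q) (q ^ 3) = chi (- (q ^ 3)) / chi (- q)"
proof -
  have q3: "norm (q ^ 3) < 1" using assms by (intro norm_power_less_one) auto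
  have "qpoch_inf (- q) q = theta (- q) (q ^ 3) * qpoch_inf (- (q ^ 3)) (q ^ 3)"
    using qpoch_inf_residues [OF assms(2), of 3 "- q"] assms(1)
    by (simp add: theta_def eval_nat_numeral mult_ac)
  then have "1 / chi (- q) = theta (- q) (q ^ 3) * (1 / chi (- (q ^ 3)))"
    using chi_minus_reciprocal [OF assms(2)] chi_minus_reciprocal [OF q3] by simp
  then show ?thesis
    using chi_nonzero [of "- (q ^ 3)"] q3 by (simp add: field_simps)
qed

lemma theta_minus_6:
  assumes "q \<noteq> 0" "norm q < 1"
  shows "theta (- q) (q ^ 6) = chi q / chi (q ^ 3)"
proof -
  have q2: "norm (q ^ 2) < 1" and q3: "norm (q ^ 3) < 1"
    using assms by (auto intro: norm_power_less_one)
  have "q ^ 6 / - q = - (q ^ 5)" using assms(1) by (simp add: eval_nat_numeral)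
  moreover have "chi q = qpoch_inf (- q) (q ^ 6) * qpoch_inf (- (q ^ 3)) (q ^ 6) * qpoch_inf (- (q ^ 5)) (q ^ 6)"
    using qpoch_inf_residues [OF q2, of 3 "- q"] by (simp add: chi_def eval_nat_numeral mult_ac)
  moreover have "chi (q ^ 3) = qpoch_inf (- (q ^ 3)) (q ^ 6)"
    by (simp add: chi_def flip: power_mult)
  ultimately show ?thesis
    using chi_nonzero [OF q3] by (simp add: theta_def)
qed

lemma rr_GH:
  assumes "q \<noteq> 0" "norm q < 1"
  shows "rr_G q * rr_H q = qpoch_inf (q ^ 5) (q ^ 5) / qpoch_inf q q"
proof -
  have "qpoch_inf q q = (\<Prod>j<5. qpoch_inf (q * q ^ j) (q ^ 5))"
    by (rule qpoch_inf_residues) (use assms in auto)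
  then have "qpoch_inf q q = qpoch_inf q (q ^ 5) * qpoch_inf (q ^ 2) (q ^ 5) * qpoch_inf (q ^ 3) (q ^ 5)
      * qpoch_inf (q ^ 4) (q ^ 5) * qpoch_inf (q ^ 5) (q ^ 5)"
    by (simp add: eval_nat_numeral)
  moreover have "norm (q ^ 5) < 1" using assms by (intro norm_power_less_one) auto
  then have "qpoch_inf (q ^ 5) (q ^ 5) \<noteq> 0"
    by (rule qpoch_inf_self_nonzero)
  ultimately show ?thesis by (simp add: rr_G_def rr_H_def mult_ac)
qed

lemma rr_GH_ratio:
  assumes "q \<noteq> 0" "norm q < 1"
  shows "rr_G q * rr_H q / (rr_G (q ^ 2) * rr_H (q ^ 2)) = chi (- (q ^ 5)) / chi (- q)"
proof -
  have n: "norm (q ^ 2) < 1" "norm (q ^ 5) < 1" "norm (q ^ 10) < 1" "q ^ 2 \<noteq> 0"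
    using assms by (auto intro: norm_power_less_one)
  have "rr_G (q ^ 2) * rr_H (q ^ 2) = qpoch_inf (q ^ 10) (q ^ 10) / qpoch_inf (q ^ 2) (q ^ 2)"
    using rr_GH [OF n(4,1)] by (simp flip: power_mult)
  moreover have "rr_G q * rr_H q = chi (- (q ^ 5)) * qpoch_inf (q ^ 10) (q ^ 10) / (chi (- q) * qpoch_inf (q ^ 2) (q ^ 2))"
    unfolding rr_GH [OF assms] using qpoch_inf_self_chi [OF assms(2)] qpoch_inf_self_chi [OF n(2)]
    by (simp flip: power_mult)
  ultimately show ?thesis
    using qpoch_inf_self_nonzero n by simp
qed

text \<open>The factor left when the two level 12 binomials are divided. The G H quotient and
  theta(-q^10; q^30) each contribute chi(-q^30), which cancels.\<close>

lemma chi_product_12: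
  assumes q: "q \<noteq> 0" "norm q < 1"
  shows "rr_G (q ^ 6) * rr_H (q ^ 6) / (rr_G (q ^ 12) * rr_H (q ^ 12))
      * (theta (- (q ^ 5)) (q ^ 30) / theta (- (q ^ 10)) (q ^ 30))
    = chi (q ^ 5) * chi (- (q ^ 10)) / (chi (- (q ^ 6)) * chi (q ^ 15))"
proof -
  have n: "norm (q ^ n) < 1" "q ^ n \<noteq> 0" if "0 < n" for n
    using q that by (auto intro: norm_power_less_one)
  have c: "chi (- (q ^ n)) \<noteq> 0" "chi (q ^ n) \<noteq> 0" if "0 < n" for n
    using n [OF that] by (auto intro!: chi_nonzero)
  have "rr_G (q ^ 6) * rr_H (q ^ 6) / (rr_G (q ^ 12) * rr_H (q ^ 12)) = chi (- (q ^ 30)) / chi (- (q ^ 6))"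
    using rr_GH_ratio [of "q ^ 6"] n q(1) by (simp flip: power_mult)
  moreover have "theta (- (q ^ 5)) (q ^ 30) = chi (q ^ 5) / chi (q ^ 15)"
    using theta_minus_6 [of "q ^ 5"] n q(1) by (simp flip: power_mult)
  moreover have "theta (- (q ^ 10)) (q ^ 30) = chi (- (q ^ 30)) / chi (- (q ^ 10))"
    using theta_minus_3 [of "q ^ 10"] n q(1) by (simp flip: power_mult)
  ultimately show ?thesis
    using c by simp
qed

text \<open>The cube of chi(-q^60) collects one factor from the G H quotient, one from theta(-q^20;
  q^60), and one from replacing chi(q^30) by chi(-q^60) / chi(-q^30).\<close>

lemma chi_product_24:
  assumes q: "q \<noteq> 0" "norm q < 1"
  shows "rr_G (q ^ 24) * rr_H (q ^ 24) / (rr_G (q ^ 12) * rr_H (q ^ 12))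
      * (theta (- (q ^ 10)) (q ^ 60) / theta (- (q ^ 20)) (q ^ 60))
    = chi (q ^ 10) * chi (- (q ^ 12)) * chi (- (q ^ 20)) * chi (- (q ^ 30)) / chi (- (q ^ 60)) ^ 3"
proof -
  have n: "norm (q ^ n) < 1" "q ^ n \<noteq> 0" if "0 < n" for n
    using q that by (auto intro: norm_power_less_one)
  have c: "chi (- (q ^ n)) \<noteq> 0" "chi (q ^ n) \<noteq> 0" if "0 < n" for n
    using n [OF that] by (auto intro!: chi_nonzero)
  have "rr_G (q ^ 12) * rr_H (q ^ 12) / (rr_G (q ^ 24) * rr_H (q ^ 24)) = chi (- (q ^ 60)) / chi (- (q ^ 12))"
    using rr_GH_ratio [of "q ^ 12"] n q(1) by (simp flip: power_mult)
  then have "rr_G (q ^ 24) * rr_H (q ^ 24) / (rr_G (q ^ 12) * rr_H (q ^ 12)) = chi (- (q ^ 12)) / chi (- (q ^ 60))"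
    by (metis inverse_divide)
  moreover have "theta (- (q ^ 10)) (q ^ 60) = chi (q ^ 10) / chi (q ^ 30)"
    using theta_minus_6 [of "q ^ 10"] n q(1) by (simp flip: power_mult)
  moreover have "theta (- (q ^ 20)) (q ^ 60) = chi (- (q ^ 60)) / chi (- (q ^ 20))"
    using theta_minus_3 [of "q ^ 20"] n q(1) by (simp flip: power_mult)
  moreover have "chi (q ^ 30) = chi (- (q ^ 60)) / chi (- (q ^ 30))"
    using chi_mult_minus [of "q ^ 30"] n c by (simp add: field_simps flip: power_mult)
  ultimately show ?thesis
    using c by (simp add: power3_eq_cube mult_ac)
qed

section \<open>The relations for W/X and Y/Z, and the passage from q to -q\<close>

context
  fixes q :: complex
  assumes q0: "q \<noteq> 0" and q1: "norm q < 1"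
begin

text \<open>The case u = 1 of \<open>relation_half_period\<close>, whose thetas are monomials by
  \<open>theta_10\<close> at q and at q^3.\<close>

lemma relation_WX:
  "rr_G q ^ 2 * rr_H q ^ 2 * rr_G (q ^ 6) * rr_H (q ^ 6)
      * (rr_H q * rr_G (q ^ 2) * rr_G (q ^ 3) * rr_G (q ^ 6) - q ^ 2 * rr_G q * rr_H (q ^ 2) * rr_H (q ^ 3) * rr_H (q ^ 6))
    = rr_G (q ^ 2) ^ 3 * rr_H (q ^ 2) ^ 3 * rr_G (q ^ 3) * rr_H (q ^ 3)
      * (rr_G q ^ 2 * rr_G (q ^ 2) * rr_G (q ^ 6) - q ^ 2 * rr_H q ^ 2 * rr_H (q ^ 2) * rr_H (q ^ 6))"
proof -
  obtain w :: complex where w: "w ^ 2 + w + 1 = 0" using cube_root_unity_ex by blast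
  have Q: "q ^ 3 \<noteq> 0" "norm (q ^ 3) < 1" using q0 q1 by (auto intro: norm_power_less_one)
  define a b c d e f g h where "a = rr_G q" "b = rr_H q" "c = rr_G (q ^ 2)" "d = rr_H (q ^ 2)"
    "e = rr_G (q ^ 3)" "f = rr_H (q ^ 3)" "g = rr_G (q ^ 6)" "h = rr_H (q ^ 6)"
  note defs = this
  have *: "g / f / (c / b) / d ^ 2 - q ^ 2 * (h / e / (d / a)) / c ^ 2
      = d / h * (c / b) ^ 2 - q ^ 2 * (c / g) * (d / a) ^ 2"
    using relation_half_period [OF q0 q1 w, of 1] theta_10 [OF q0 q1] theta_10 [OF Q]
    unfolding defs by (simp add: mult.assoc flip: power_mult)
  have nz: "a \<noteq> 0" "b \<noteq> 0" "c \<noteq> 0" "d \<noteq> 0" "e \<noteq> 0" "f \<noteq> 0" "g \<noteq> 0" "h \<noteq> 0"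
    using rr_all_nonzero [OF q0 q1] by (simp_all add: defs)
  have "a ^ 2 * b ^ 2 * g * h * (b * c * e * g - q ^ 2 * a * d * f * h)
    = c ^ 2 * d ^ 2 * e * f * g * h * a ^ 2 * b ^ 2 * (g / f / (c / b) / d ^ 2 - q ^ 2 * (h / e / (d / a)) / c ^ 2)"
    using nz by (simp add: field_simps power2_eq_square)
  also have "\<dots> = c ^ 3 * d ^ 3 * e * f * (a ^ 2 * c * g - q ^ 2 * b ^ 2 * d * h)"
    unfolding * using nz by (simp add: field_simps power2_eq_square power3_eq_cube)
  finally show ?thesis unfolding defs .
qed

text \<open>The case u = -1 of \<open>relation_half_period\<close>, with
  \<open>theta_minus_10\<close> in place of \<open>theta_10\<close>.\<close>

lemma relation_YZ:
  "rr_G (q ^ 2) * rr_H (q ^ 2) * (rr_G (q ^ 2) ^ 2 * rr_H (q ^ 3) * rr_G (q ^ 12) * rr_G q * rr_H (q ^ 4)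
      - q ^ 2 * rr_H (q ^ 2) ^ 2 * rr_G (q ^ 3) * rr_H (q ^ 12) * rr_H q * rr_G (q ^ 4))
    = rr_G q * rr_H q * rr_G (q ^ 4) * rr_H (q ^ 4) * (rr_H q ^ 2 * rr_G (q ^ 4) ^ 2 * rr_G (q ^ 6) * rr_H (q ^ 2)
      - q ^ 2 * rr_G q ^ 2 * rr_H (q ^ 4) ^ 2 * rr_H (q ^ 6) * rr_G (q ^ 2))"
proof -
  obtain w :: complex where w: "w ^ 2 + w + 1 = 0" using cube_root_unity_ex by blast
  have Q: "q ^ 3 \<noteq> 0" "norm (q ^ 3) < 1" using q0 q1 by (auto intro: norm_power_less_one)
  define a b c d e f g h k l m n where "a = rr_G q" "b = rr_H q" "c = rr_G (q ^ 2)" "d = rr_H (q ^ 2)"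
    "e = rr_G (q ^ 3)" "f = rr_H (q ^ 3)" "g = rr_G (q ^ 6)" "h = rr_H (q ^ 6)"
    "k = rr_G (q ^ 4)" "l = rr_H (q ^ 4)" "m = rr_G (q ^ 12)" "n = rr_H (q ^ 12)"
  note defs = this
  have *: "f * m / (g * h) / (b * k / (c * d)) / d ^ 2 - q ^ 2 * (e * n / (g * h) / (a * l / (c * d))) / c ^ 2
      = d / h * (b * k / (c * d)) ^ 2 - q ^ 2 * (c / g) * (a * l / (c * d)) ^ 2"
    using relation_half_period [OF q0 q1 w, of "- 1"] theta_minus_10 [OF q0 q1] theta_minus_10 [OF Q]
    unfolding defs by (simp add: mult.assoc flip: power_mult)
  have nz: "a \<noteq> 0" "b \<noteq> 0" "c \<noteq> 0" "d \<noteq> 0" "e \<noteq> 0" "f \<noteq> 0" "g \<noteq> 0" "h \<noteq> 0"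
    "k \<noteq> 0" "l \<noteq> 0" "m \<noteq> 0" "n \<noteq> 0"
    using rr_all_nonzero [OF q0 q1] by (simp_all add: defs)
  have "c * d * (c ^ 2 * f * m * a * l - q ^ 2 * d ^ 2 * e * n * b * k)
    = g * h * a * b * k * l * c ^ 2 * d ^ 2
      * (f * m / (g * h) / (b * k / (c * d)) / d ^ 2 - q ^ 2 * (e * n / (g * h) / (a * l / (c * d))) / c ^ 2)"
    using nz by (simp add: field_simps power2_eq_square)
  also have "\<dots> = a * b * k * l * (b ^ 2 * k ^ 2 * g * d - q ^ 2 * a ^ 2 * l ^ 2 * h * c)"
    unfolding * using nz by (simp add: field_simps power2_eq_square)
  finally show ?thesis unfolding defs .
qed

text \<open>Base -q^5 splits into base q^10, where the resulting thetas are already known. The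
  formulas transport \<open>rr_cubic_nonzero\<close> to -q.\<close>

lemma rr_minus:
  "rr_G (- q) = rr_G (q ^ 2) * rr_H (q ^ 2) ^ 2 / (rr_G q * rr_H (q ^ 4))"
  "rr_H (- q) = rr_G (q ^ 2) ^ 2 * rr_H (q ^ 2) / (rr_H q * rr_G (q ^ 4))"
proof -
  have p: "norm (- (q ^ 5)) < 1" "- (q ^ 5) \<noteq> 0"
    using q0 norm_power_less_one [OF q1, of 5] by auto
  have "theta (- q) (- (q ^ 5)) = theta (- q) (q ^ 10) * theta (q ^ 6) (q ^ 10)"
    using theta_split2 [OF p, of "- q"] q0 by (simp flip: power_mult power_Suc)
  also have "theta (q ^ 6) (q ^ 10) = 1 / rr_H (q ^ 2)"
    using theta_reflect_power(1) [OF q0 q1, of 6 4 10] theta_rr_H [of "q ^ 2"] q0 by (simp flip: power_mult)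
  finally show "rr_G (- q) = rr_G (q ^ 2) * rr_H (q ^ 2) ^ 2 / (rr_G q * rr_H (q ^ 4))"
    using rr_G_eq_theta [of "- q"] q0 theta_minus_10 [OF q0 q1] by (simp add: power2_eq_square [of "rr_H (q ^ 2)"])
  have "theta (q ^ 2) (- (q ^ 5)) = theta (q ^ 2) (q ^ 10) * theta (- (q ^ 7)) (q ^ 10)"
    using theta_split2 [OF p, of "q ^ 2"] q0 by (simp flip: power_mult power_add)
  also have "theta (- (q ^ 7)) (q ^ 10) = theta (- (q ^ 3)) (q ^ 10)"
    using theta_reflect_power(2) [OF q0 q1, of 7 3 10] by simp
  also have "theta (q ^ 2) (q ^ 10) = 1 / rr_G (q ^ 2)"
    using theta_rr_G [of "q ^ 2"] q0 by (simp flip: power_mult)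
  finally show "rr_H (- q) = rr_G (q ^ 2) ^ 2 * rr_H (q ^ 2) / (rr_H q * rr_G (q ^ 4))"
    using rr_H_eq_theta [of "- q"] q0 theta_minus_10 [OF q0 q1] by (simp add: power2_eq_square [of "rr_G (q ^ 2)"])
qed

end

text \<open>This is \<open>rr_cubic_nonzero\<close> at -q, rewritten by \<open>rr_minus\<close> at q
  and at q^3; note (-q)^3 = -(q^3).\<close>

lemma rr_cubic_minus_nonzero:
  assumes q0: "q \<noteq> 0" and q1: "norm q < 1"
  shows "rr_G (q ^ 2) ^ 3 * rr_H (q ^ 3) * rr_G (q ^ 12) * (rr_G q ^ 3 * rr_H (q ^ 4) ^ 3 * rr_H (q ^ 6))
    \<noteq> rr_H (q ^ 2) ^ 3 * rr_G (q ^ 3) * rr_H (q ^ 12) * (rr_H q ^ 3 * rr_G (q ^ 4) ^ 3 * rr_G (q ^ 6))"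
proof
  have Q: "q ^ 3 \<noteq> 0" "norm (q ^ 3) < 1" using q0 q1 by (auto intro: norm_power_less_one)
  define a b c d e f g h k l m n where "a = rr_G q" "b = rr_H q" "c = rr_G (q ^ 2)" "d = rr_H (q ^ 2)"
    "e = rr_G (q ^ 3)" "f = rr_H (q ^ 3)" "g = rr_G (q ^ 6)" "h = rr_H (q ^ 6)"
    "k = rr_G (q ^ 4)" "l = rr_H (q ^ 4)" "m = rr_G (q ^ 12)" "n = rr_H (q ^ 12)"
  note defs = this
  have nz: "a \<noteq> 0" "b \<noteq> 0" "c \<noteq> 0" "d \<noteq> 0" "e \<noteq> 0" "f \<noteq> 0" "g \<noteq> 0" "h \<noteq> 0"
    "k \<noteq> 0" "l \<noteq> 0" "m \<noteq> 0" "n \<noteq> 0"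
    using rr_all_nonzero [OF q0 q1] by (simp_all add: defs)
  have ne: "(c ^ 2 * d / (b * k)) ^ 3 * (g * h ^ 2 / (e * n)) \<noteq> (c * d ^ 2 / (a * l)) ^ 3 * (g ^ 2 * h / (f * m))"
    using rr_cubic_nonzero [of "- q"] rr_minus [OF q0 q1] rr_minus [OF Q] q0 q1
    unfolding defs by (simp flip: power_mult)
  assume "rr_G (q ^ 2) ^ 3 * rr_H (q ^ 3) * rr_G (q ^ 12) * (rr_G q ^ 3 * rr_H (q ^ 4) ^ 3 * rr_H (q ^ 6))
    = rr_H (q ^ 2) ^ 3 * rr_G (q ^ 3) * rr_H (q ^ 12) * (rr_H q ^ 3 * rr_G (q ^ 4) ^ 3 * rr_G (q ^ 6))"
  then have *: "c ^ 3 * f * m * (a ^ 3 * l ^ 3 * h) = d ^ 3 * e * n * (b ^ 3 * k ^ 3 * g)"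
    by (simp add: defs)
  have "(c ^ 2 * d / (b * k)) ^ 3 * (g * h ^ 2 / (e * n))
    = c ^ 3 * d ^ 3 * g * h / (a ^ 3 * b ^ 3 * k ^ 3 * l ^ 3 * e * f * m * n) * (c ^ 3 * f * m * (a ^ 3 * l ^ 3 * h))"
    using nz by (simp add: field_simps power2_eq_square power3_eq_cube)
  also have "\<dots> = (c * d ^ 2 / (a * l)) ^ 3 * (g ^ 2 * h / (f * m))"
    unfolding * using nz by (simp add: field_simps power2_eq_square power3_eq_cube)
  finally show False using ne by simp
qed

text \<open>The shared theta constant \<open>C\<close> cancels. If \<open>B\<close> or
  \<open>T'\<close> is zero, both sides are 0 by the convention x / 0 = 0.\<close>

lemma ratio_cancel:
  fixes C :: "'a :: field"
  assumes "N = A * T * C" "D = B * T' * C" "C \<noteq> 0"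
  shows "N / D = A / B * (T / T')"
  using assms by simp

theorem theorem1p5:
  fixes q t S T U V W X Y Z :: complex and R :: "nat \<Rightarrow> complex"
  assumes "0 < norm q" and "norm q < 1"
    and "t ^ 5 = q"
    and "\<And>n. n > 0 \<Longrightarrow> R n = rr_R (t ^ n) (q ^ n)"
    and "S = rr_G q ^ 2 * rr_H (q ^ 2) * rr_G (q ^ 3) * rr_H (q ^ 4) ^ 2 * rr_H (q ^ 12)"
    and "T = rr_H q ^ 2 * rr_G (q ^ 2) * rr_H (q ^ 3) * rr_G (q ^ 4) ^ 2 * rr_G (q ^ 12)"
    and "U = rr_G q ^ 3 * rr_H q ^ 3 * rr_H (q ^ 6) - rr_H (q ^ 2) ^ 3 * rr_G (q ^ 3) * rr_H (q ^ 3)"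
    and "V = rr_G q ^ 3 * rr_H q ^ 3 * rr_G (q ^ 6) - rr_G (q ^ 2) ^ 3 * rr_G (q ^ 3) * rr_H (q ^ 3)"
    and "W = rr_H q ^ 3 * rr_G (q ^ 6) * rr_H (q ^ 6) - rr_G (q ^ 2) ^ 3 * rr_H (q ^ 2) ^ 3 * rr_H (q ^ 3)"
    and "X = rr_G q ^ 3 * rr_G (q ^ 6) * rr_H (q ^ 6) - rr_G (q ^ 2) ^ 3 * rr_H (q ^ 2) ^ 3 * rr_G (q ^ 3)"
    and "Y = rr_G (q ^ 2) ^ 3 * rr_H (q ^ 3) * rr_G (q ^ 12) - rr_H q ^ 3 * rr_G (q ^ 4) ^ 3 * rr_G (q ^ 6)"
    and "Z = rr_H (q ^ 2) ^ 3 * rr_G (q ^ 3) * rr_H (q ^ 12) - rr_G q ^ 3 * rr_H (q ^ 4) ^ 3 * rr_H (q ^ 6)"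
  shows
    "((rr_H q * rr_H (q ^ 3) ^ 2 * rr_G (q ^ 12) + q * rr_G q * rr_G (q ^ 3) ^ 2 * rr_H (q ^ 12))
       / (rr_G q * rr_G (q ^ 3) * rr_H (q ^ 6) * rr_G (q ^ 12) + q ^ 2 * rr_H q * rr_H (q ^ 3) * rr_G (q ^ 6) * rr_H (q ^ 12))
     = chi (q ^ 5) * chi (- (q ^ 10)) / (chi (- (q ^ 6)) * chi (q ^ 15)))
    \<and> ((U * rr_G (q ^ 2) * rr_H (q ^ 3) * rr_G (q ^ 12) - q * V * rr_H (q ^ 2) * rr_G (q ^ 3) * rr_H (q ^ 12))
       / (V * rr_H (q ^ 2) * rr_H (q ^ 6) * rr_G (q ^ 12) - q ^ 2 * U * rr_G (q ^ 2) * rr_G (q ^ 6) * rr_H (q ^ 12))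
     = chi (q ^ 5) * chi (- (q ^ 10)) / (chi (- (q ^ 6)) * chi (q ^ 15)))
    \<and> ((W * rr_G q * rr_H (q ^ 12) * rr_G (q ^ 24) - q ^ 2 * X * rr_H q * rr_G (q ^ 12) * rr_H (q ^ 24))
       / (q ^ 4 * W * rr_G q * rr_G (q ^ 6) * rr_H (q ^ 24) - X * rr_H q * rr_H (q ^ 6) * rr_G (q ^ 24))
     = q ^ 3 * (chi (q ^ 10) * chi (- (q ^ 12)) * chi (- (q ^ 20)) * chi (- (q ^ 30)) / chi (- (q ^ 60)) ^ 3))
    \<and> ((S * Y * rr_H (q ^ 12) * rr_G (q ^ 24) - q ^ 2 * T * Z * rr_G (q ^ 12) * rr_H (q ^ 24))
       / (T * Z * rr_H (q ^ 6) * rr_G (q ^ 24) - q ^ 4 * S * Y * rr_G (q ^ 6) * rr_H (q ^ 24))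
     = q ^ 3 * (chi (q ^ 10) * chi (- (q ^ 12)) * chi (- (q ^ 20)) * chi (- (q ^ 30)) / chi (- (q ^ 60)) ^ 3))
    \<and> (V / (t ^ 6 * U) = R 1 * R 3 / (R 2 ^ 2 * R 6))
    \<and> (t ^ 3 * W / X = R 1 ^ 2 * R 2 * R 3 * R 6)
    \<and> (Y / (q ^ 3 * Z) = R 1 / (R 2 * R 4))"
proof -
  note defs = assms(5-12)
  have q0: "q \<noteq> 0" and q1: "norm q < 1" using assms(1,2) by auto
  have t0: "t \<noteq> 0" using q0 assms(3) by auto
  have R: "R n = t ^ n * rr_H (q ^ n) / rr_G (q ^ n)" if "0 < n" for n
    using assms(4) [OF that] by (simp add: rr_R_def)
  define g1 h1 g2 h2 g3 h3 g4 h4 g6 h6 g12 h12 g24 h24 where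
    "g1 = rr_G q" "h1 = rr_H q" "g2 = rr_G (q ^ 2)" "h2 = rr_H (q ^ 2)"
    "g3 = rr_G (q ^ 3)" "h3 = rr_H (q ^ 3)" "g4 = rr_G (q ^ 4)" "h4 = rr_H (q ^ 4)"
    "g6 = rr_G (q ^ 6)" "h6 = rr_H (q ^ 6)" "g12 = rr_G (q ^ 12)" "h12 = rr_H (q ^ 12)"
    "g24 = rr_G (q ^ 24)" "h24 = rr_H (q ^ 24)"
  note gh = this
  have nz: "g1 \<noteq> 0" "h1 \<noteq> 0" "g2 \<noteq> 0" "h2 \<noteq> 0" "g3 \<noteq> 0" "h3 \<noteq> 0" "g4 \<noteq> 0" "h4 \<noteq> 0"
    "g6 \<noteq> 0" "h6 \<noteq> 0" "g12 \<noteq> 0" "h12 \<noteq> 0" "g24 \<noteq> 0" "h24 \<noteq> 0"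
    unfolding gh using rr_all_nonzero [OF q0 q1] by simp_all
  define C where "C = theta (q ^ 3) (q ^ 15) * theta (q ^ 6) (q ^ 15)"
  define C' where "C' = theta (q ^ 6) (q ^ 30) * theta (q ^ 12) (q ^ 30)"
  have C0: "C \<noteq> 0" "C' \<noteq> 0"
    using theta_power_nonzero(1) [OF q0 q1] by (simp_all add: C_def C'_def)
  define T5 where "T5 = theta (- (q ^ 5)) (q ^ 30)"
  define T10 where "T10 = theta (- (q ^ 10)) (q ^ 30)"
  define T10' where "T10' = theta (- (q ^ 10)) (q ^ 60)"
  define T20 where "T20 = theta (- (q ^ 20)) (q ^ 60)"
  note cdefs = C_def C'_def T5_def T10_def T10'_def T20_def
  note L12p = level12_plus [OF q0 q1, folded cdefs gh]
  note L12m = level12_minus [OF q0 q1, folded cdefs gh]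
  note L24p = level24_plus [OF q0 q1, folded cdefs gh]
  note L24m = level24_minus [OF q0 q1, folded cdefs gh]
  note E12 = chi_product_12 [OF q0 q1, folded cdefs gh]
  note E24 = chi_product_24 [OF q0 q1, folded cdefs gh]
  note defs = defs [folded gh]

  \<comment> \<open>The multipliers come from the claimed value of V/U. Collecting the first terms
    of \<open>V\<close> and \<open>U\<close> and then their second terms produces exactly the two
    sides of \<open>relation_VU\<close>.\<close>
  have VU: "V * (h2 ^ 2 * h6 * g1 * g3) = U * (h1 * h3 * g2 ^ 2 * g6)"
  proof -
    have "V * (h2 ^ 2 * h6 * g1 * g3) - U * (h1 * h3 * g2 ^ 2 * g6)
      = g1 ^ 3 * h1 ^ 3 * g6 * h6 * (h2 ^ 2 * g1 * g3 - h1 * h3 * g2 ^ 2)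
        - g3 * h3 * g2 ^ 2 * h2 ^ 2 * (g1 * g2 * g3 * h6 - h1 * h2 * h3 * g6)"
      unfolding defs by (simp add: algebra_simps power2_eq_square power3_eq_cube)
    then show ?thesis using relation_VU [OF q0 q1, folded gh] by simp
  qed
  \<comment> \<open>If \<open>U\<close> were 0, then \<open>V\<close> would be 0 as well;
    eliminating the products common to the two equations leaves the cubic equality excluded at q^2.
    The arguments for \<open>X\<close> and \<open>Z\<close> run the same way.\<close>
  have U0: "U \<noteq> 0"
  proof
    assume U: "U = 0"
    then have "V = 0" using VU nz by simp
    with U have "g1 ^ 3 * h1 ^ 3 * h6 = h2 ^ 3 * g3 * h3" "g1 ^ 3 * h1 ^ 3 * g6 = g2 ^ 3 * g3 * h3"
      unfolding defs by simp_all
    then have "(g1 ^ 3 * h1 ^ 3) * (h2 ^ 3 * g6) = (g1 ^ 3 * h1 ^ 3) * (g2 ^ 3 * h6)" by algebra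
    then have "h2 ^ 3 * g6 = g2 ^ 3 * h6" using nz by simp
    moreover have "h2 ^ 3 * g6 \<noteq> g2 ^ 3 * h6"
      using rr_cubic_nonzero [of "q ^ 2"] q0 norm_power_less_one [OF q1, of 2] unfolding gh
      by (simp flip: power_mult)
    ultimately show False by simp
  qed
  have V_eq: "V = U * (h1 * h3 * g2 ^ 2 * g6 / (h2 ^ 2 * h6 * g1 * g3))"
    using VU nz by (simp add: field_simps)

  have WX: "W * (g1 ^ 2 * g2 * g3 * g6) = q ^ 2 * X * (h1 ^ 2 * h2 * h3 * h6)"
  proof -
    have "W * (g1 ^ 2 * g2 * g3 * g6) - q ^ 2 * X * (h1 ^ 2 * h2 * h3 * h6)
      = g1 ^ 2 * h1 ^ 2 * g6 * h6 * (h1 * g2 * g3 * g6 - q ^ 2 * g1 * h2 * h3 * h6)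
        - g2 ^ 3 * h2 ^ 3 * g3 * h3 * (g1 ^ 2 * g2 * g6 - q ^ 2 * h1 ^ 2 * h2 * h6)"
      unfolding defs by (simp add: algebra_simps power2_eq_square power3_eq_cube)
    then show ?thesis using relation_WX [OF q0 q1, folded gh] by simp
  qed
  have X0: "X \<noteq> 0"
  proof
    assume X: "X = 0"
    then have "W = 0" using WX nz by simp
    with X have "h1 ^ 3 * g6 * h6 = g2 ^ 3 * h2 ^ 3 * h3" "g1 ^ 3 * g6 * h6 = g2 ^ 3 * h2 ^ 3 * g3"
      unfolding defs by simp_all
    then have "(g6 * h6) * (h1 ^ 3 * g3) = (g6 * h6) * (g1 ^ 3 * h3)" by algebra
    then have "h1 ^ 3 * g3 = g1 ^ 3 * h3" using nz by simp
    then show False using rr_cubic_nonzero [OF q0 q1] unfolding gh by simp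
  qed
  have W_eq: "W = q ^ 2 * X * (h1 ^ 2 * h2 * h3 * h6 / (g1 ^ 2 * g2 * g3 * g6))"
    using WX nz by (simp add: field_simps)

  have YZ: "Y * (g1 * h2 * h4) = q ^ 2 * Z * (h1 * g2 * g4)"
  proof -
    have "Y * (g1 * h2 * h4) - q ^ 2 * Z * (h1 * g2 * g4)
      = g2 * h2 * (g2 ^ 2 * h3 * g12 * g1 * h4 - q ^ 2 * h2 ^ 2 * g3 * h12 * h1 * g4)
        - g1 * h1 * g4 * h4 * (h1 ^ 2 * g4 ^ 2 * g6 * h2 - q ^ 2 * g1 ^ 2 * h4 ^ 2 * h6 * g2)"
      unfolding defs by (simp add: algebra_simps power2_eq_square power3_eq_cube)
    then show ?thesis using relation_YZ [OF q0 q1, folded gh] by simp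
  qed
  have Z0: "Z \<noteq> 0"
  proof
    assume Z: "Z = 0"
    then have "Y = 0" using YZ nz by simp
    with Z have "g2 ^ 3 * h3 * g12 = h1 ^ 3 * g4 ^ 3 * g6" "h2 ^ 3 * g3 * h12 = g1 ^ 3 * h4 ^ 3 * h6"
      unfolding defs by simp_all
    then show False
      using rr_cubic_minus_nonzero [OF q0 q1, folded gh] by (metis mult.commute)
  qed
  have Y_eq: "Y = q ^ 2 * Z * (h1 * g2 * g4 / (g1 * h2 * h4))"
    using YZ nz by (simp add: field_simps)

  have part1: "(h1 * h3 ^ 2 * g12 + q * g1 * g3 ^ 2 * h12) / (g1 * g3 * h6 * g12 + q ^ 2 * h1 * h3 * g6 * h12)
      = g6 * h6 / (g12 * h12) * (T5 / T10)"
    using ratio_cancel [OF L12p(2,1) C0(1)] nz by simp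

  have "U * g2 * h3 * g12 - q * V * h2 * g3 * h12
      = U * g2 * h3 / (g1 * h2 * h6) * (g1 * h2 * h6 * g12 - q * h1 * g2 * g6 * h12)"
    unfolding V_eq using nz by (simp add: field_simps power2_eq_square)
  also have "\<dots> = U * g2 ^ 2 * h3 * g6 / g1 * T5 * C"
    unfolding L12m(2) using nz by (simp add: field_simps power2_eq_square)
  finally have n2: "U * g2 * h3 * g12 - q * V * h2 * g3 * h12 = U * g2 ^ 2 * h3 * g6 / g1 * T5 * C" .
  have "V * h2 * h6 * g12 - q ^ 2 * U * g2 * g6 * h12
      = U * g2 / (g1 * h2 * g3 * h6) * (g6 * h6 * (h1 * h3 * g2 * g12 - q ^ 2 * g1 * g3 * h2 * h12))"
    unfolding V_eq using nz by (simp add: field_simps power2_eq_square)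
  also have "\<dots> = U * g2 ^ 2 * h3 * g12 * h12 / (g1 * h6) * T10 * C"
    unfolding L12m(1) using nz by (simp add: field_simps power2_eq_square)
  finally have d2: "V * h2 * h6 * g12 - q ^ 2 * U * g2 * g6 * h12
      = U * g2 ^ 2 * h3 * g12 * h12 / (g1 * h6) * T10 * C" .
  have part2: "(U * g2 * h3 * g12 - q * V * h2 * g3 * h12) / (V * h2 * h6 * g12 - q ^ 2 * U * g2 * g6 * h12)
      = g6 * h6 / (g12 * h12) * (T5 / T10)"
    using ratio_cancel [OF n2 d2 C0(1)] nz U0 by simp

  have "W * g1 * h12 * g24 - q ^ 2 * X * h1 * g12 * h24
      = - (q ^ 2 * X * h1 / (g1 * g2 * g3 * g6))
        * (g1 * g2 * g3 * g6 * g12 * h24 - h1 * h2 * h3 * h6 * h12 * g24)"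
    unfolding W_eq using nz by (simp add: field_simps power2_eq_square [of g1] power2_eq_square [of h1])
  also have "\<dots> = - (q ^ 2 * q * X * h1 ^ 2 * h6 * g24 * h24 / (g2 * g3)) * T10' * C'"
    unfolding L24p(1) using nz by (simp add: field_simps power2_eq_square [of h1])
  finally have n3: "W * g1 * h12 * g24 - q ^ 2 * X * h1 * g12 * h24
      = - (q ^ 2 * q * X * h1 ^ 2 * h6 * g24 * h24 / (g2 * g3)) * T10' * C'" .
  have "q ^ 4 * W * g1 * g6 * h24 - X * h1 * h6 * g24
      = - (X * h1 * h6 / (g1 * g2 * g3)) * (g1 * g2 * g3 * g24 - q ^ 6 * h1 * h2 * h3 * h24)"
    unfolding W_eq using nz by (simp add: field_simps power2_eq_square [of g1] power2_eq_square [of h1] flip: power_add)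
  also have "\<dots> = - (X * h1 ^ 2 * h6 * g12 * h12 / (g2 * g3)) * T20 * C'"
    unfolding L24p(2) using nz by (simp add: field_simps power2_eq_square [of h1])
  finally have d3: "q ^ 4 * W * g1 * g6 * h24 - X * h1 * h6 * g24
      = - (X * h1 ^ 2 * h6 * g12 * h12 / (g2 * g3)) * T20 * C'" .
  have part3: "(W * g1 * h12 * g24 - q ^ 2 * X * h1 * g12 * h24) / (q ^ 4 * W * g1 * g6 * h24 - X * h1 * h6 * g24)
      = q ^ 3 * (g24 * h24 / (g12 * h12) * (T10' / T20))"
    using ratio_cancel [OF n3 d3 C0(2)] nz X0 by (simp add: power3_eq_cube power2_eq_square)

  \<comment> \<open>The common part of \<open>S * Y\<close> and \<open>T * Z\<close>:
    \<open>S\<close> absorbs the denominator of Y/Z, and what is left of \<open>S\<close> and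
    \<open>T\<close> supplies the monomials of \<open>level24_minus\<close>.\<close>
  define K where "K = Z * h1 * g2 * g4"
  have K0: "K \<noteq> 0" using nz Z0 by (simp add: K_def)
  have SY: "S * Y = q ^ 2 * K * (g1 * g3 * h4 * h12)"
    unfolding Y_eq defs(1) K_def using nz by (simp add: field_simps power2_eq_square [of g1] power2_eq_square [of h4])
  have TZ: "T * Z = K * (h1 * h3 * g4 * g12)"
    unfolding defs(2) K_def by (simp add: power2_eq_square)
  have "S * Y * h12 * g24 - q ^ 2 * T * Z * g12 * h24
      = q ^ 2 * K / (g6 * h6) * (g6 * h6 * (g1 * g3 * h4 * h12 ^ 2 * g24 - h1 * h3 * g4 * g12 ^ 2 * h24))"
  proof -
    have e: "q ^ 2 * T * Z = q ^ 2 * (K * (h1 * h3 * g4 * g12))"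
      using TZ by (simp add: mult.assoc)
    show ?thesis unfolding SY e using nz
      by (simp add: field_simps power2_eq_square [of g12] power2_eq_square [of h12])
  qed
  also have "\<dots> = q ^ 2 * q * K / (g6 * h6) * (g2 * h2 * g3 * h3 * g12 * h12 * g24 * h24) * T10' * C'"
    unfolding L24m(1) by simp
  finally have n4: "S * Y * h12 * g24 - q ^ 2 * T * Z * g12 * h24
      = q ^ 2 * q * K / (g6 * h6) * (g2 * h2 * g3 * h3 * g12 * h12 * g24 * h24) * T10' * C'" .
  have "T * Z * h6 * g24 - q ^ 4 * S * Y * g6 * h24
      = K / (g6 * h6) * (g6 * h6 * (h1 * h3 * h6 * g4 * g12 * g24 - q ^ 6 * g1 * g3 * g6 * h4 * h12 * h24))"
  proof -
    have e: "q ^ 4 * S * Y = q ^ 6 * (K * (g1 * g3 * h4 * h12))"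
      using SY by (simp add: mult.assoc)
    show ?thesis unfolding TZ e using nz by (simp add: field_simps)
  qed
  also have "\<dots> = K / (g6 * h6) * (g2 * h2 * g3 * h3 * g12 ^ 2 * h12 ^ 2) * T20 * C'"
    unfolding L24m(2) by simp
  finally have d4: "T * Z * h6 * g24 - q ^ 4 * S * Y * g6 * h24
      = K / (g6 * h6) * (g2 * h2 * g3 * h3 * g12 ^ 2 * h12 ^ 2) * T20 * C'" .
  have part4: "(S * Y * h12 * g24 - q ^ 2 * T * Z * g12 * h24) / (T * Z * h6 * g24 - q ^ 4 * S * Y * g6 * h24)
      = q ^ 3 * (g24 * h24 / (g12 * h12) * (T10' / T20))"
    using ratio_cancel [OF n4 d4 C0(2)] nz K0 by (simp add: power3_eq_cube power2_eq_square)

  have R': "R 1 = t * h1 / g1" "R 2 = t ^ 2 * h2 / g2" "R 3 = t ^ 3 * h3 / g3" "R 4 = t ^ 4 * h4 / g4"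
    "R 6 = t ^ 6 * h6 / g6"
    by (simp_all add: R gh)
  \<comment> \<open>The powers of t balance: 1 + 3 - 4 - 6 = -6 here; in the next two identities 2 +
    2 + 3 + 6 = 13 matches t^3 q^2, and 1 - 2 - 4 = -5 matches q^2 / q^3.\<close>
  have part5: "V / (t ^ 6 * U) = R 1 * R 3 / (R 2 ^ 2 * R 6)"
    unfolding V_eq R' using nz t0 U0
    by (simp add: field_simps power_mult_distrib flip: power_mult power_add power_Suc)
  have part6: "t ^ 3 * W / X = R 1 ^ 2 * R 2 * R 3 * R 6"
    unfolding W_eq R' assms(3) [symmetric] using nz t0 X0
    by (simp add: field_simps power_mult_distrib flip: power_mult power_add power_Suc)
  have part7: "Y / (q ^ 3 * Z) = R 1 / (R 2 * R 4)"
    unfolding Y_eq R' assms(3) [symmetric] using nz t0 Z0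
    by (simp add: field_simps power_mult_distrib flip: power_mult power_add power_Suc)
  show ?thesis
    unfolding gh [symmetric] E12 [symmetric] E24 [symmetric]
    by (intro conjI part1 part2 part3 part4 part5 part6 part7)
qed

end
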